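(* Let $a_3(n)$ be defined by \[\sum_{n\geq 0}a_3(n)q^n=\frac{f_3f_6}{f_1f_2},\qquad f_k=\prod_{m=1}^{\infty}(1-q^{km}).\] Then for every integer $\alpha\geq 0$ and every integer $n\geq 0$, \begin{align*} a_3\left(3^{2\alpha}n+\frac{3^{2\alpha}-1}{4}\right)&\equiv 0 \pmod{3^{\alpha}},\\ a_3\left(3^{2\alpha+1}n+\frac{3^{2\alpha+2}-1}{4}\right)&\equiv 0 \pmod{3^{\alpha+1}},\\ a_3\left(3^{2\alpha+2}n+\frac{7\cdot 3^{2\alpha+1}-1}{4}\right)&\equiv 0 \pmod{3^{\alpha+2}},\\ a_3\left(3^{2\alpha+2}n+\frac{11\cdot 3^{2\alpha+1}-1}{4}\right)&\equiv 0 \pmod{3^{\alpha+2}}. \end{align*}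
   Context: $a_3(n)$ is the number of 3-regular cubic partitions of $n$; its generating function is as given, where $f_k=(q^k;q^k)_\infty$. *)

theory Defs
  imports "HOL-Computational_Algebra.Formal_Power_Series"
begin

definition f_trunc :: "nat \<Rightarrow> nat \<Rightarrow> rat fps" where
  "f_trunc k N = (\<Prod>m\<in>{1..N}. 1 - fps_X ^ (k * m))"

text \<open>a_3(n) = n-th coefficient of f_3 f_6 / (f_1 f_2). Factors with index m > n do not
  affect the coefficient of q^n, so truncating the products at N = n is exact.\<close>
definition a3 :: "nat \<Rightarrow> rat" where
  "a3 n = fps_nth (f_trunc 3 n * f_trunc 6 n / (f_trunc 1 n * f_trunc 2 n)) n"

end

(* Let g = f_3 f_6 / (f_1 f_2), and let U extract the coefficients of q^(3n). Jacobi's triple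
   product gives the 3-dissections of phi(-q) = f_1^2 / f_2 and psi(q) = f_2^2 / f_1, hence
   f_1 f_2 = f_9 f_18 (P - q - 2 q^2 / P) for a series P in q^3. The norm of this identity over
   q -> omega q expresses P^3 - 7 q^3 - 8 q^6 / P^3 through g(q^3). Consequently
   Z = 3 q f_9 f_18 / (f_1 f_2) satisfies Z^3 = 3 tau(q^3) (1 + Z + Z^2) with tau = 9 q g^4, and
   U(Z^k) obeys the corresponding linear recurrence with coefficients 3 tau. So U(Z^k) is divisible
   by tau^j in the ring Z[tau] for 3j <= k + 2, and by 3 tau^j if moreover k >= 3 and j > 0.
   In terms of g, the trisections with residues 2 and 0 map g Z[tau] into 3 g^3 Z[tau] and
   g^3 Z[tau] into g Z[tau], so each pair of trisections gains a factor 3. The last two congruences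
   gain another 3 because g^3 is congruent to g(q^3) modulo 3. *)

theory Submission
  imports Defs "HOL-Computational_Algebra.Formal_Laurent_Series"
begin

subsection \<open>Limits and infinite products of formal power series\<close>

text \<open>The quarters in the theorem and the two residues have one source: q^(1/4) g is an eta
  quotient and q g^4 is its fourth power. So g times a power of \<tau> has exponents n + 1/4, and
  g^3 times a power of \<tau> has exponents n + 3/4. Keeping those with numerator divisible by 3
  means n = 2 modulo 3 in the first case and n = 0 in the second, and each case leads to the other.
  Up to a power of 3, a power of q and a series in q^3, g \<tau>^i and g^3 \<tau>^i are Z^(4i+1) and
  Z^(4i+3), which is why powers of Z are what has to be trisected. The count of threes is tight: Z^k
  hides 3^k and \<tau>^j hides 9^j. Against \<tau>^(i+1), the power k = 4i+1 leaves one factor 3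
  over, while k = 4i+3 falls one short. The factor 3 in the sharper divisibility pays exactly for
  that deficit, so the gain per round comes from residue 2.\<close>

lemma tendsto_mult_fps:
  fixes a b :: "'a::comm_ring_1 fps"
  assumes "(f \<longlongrightarrow> a) F" "(g \<longlongrightarrow> b) F"
  shows "((\<lambda>x. f x * g x) \<longlongrightarrow> a * b) F"
proof (rule tendsto_fpsI)
  fix n
  have "eventually (\<lambda>x. \<forall>k\<le>n. f x $ k = a $ k) F" "eventually (\<lambda>x. \<forall>k\<le>n. g x $ k = b $ k) F"
    using assms eventually_fps_nth_eq_nhds_fps_strong unfolding filterlim_iff by blast+
  then show "eventually (\<lambda>x. (f x * g x) $ n = (a * b) $ n) F"
    by eventually_elim (auto simp: fps_mult_nth intro!: sum.cong)
qed

lemma tendsto_power_fps: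
  fixes a :: "'a::comm_ring_1 fps"
  assumes "(f \<longlongrightarrow> a) F"
  shows "((\<lambda>x. f x ^ k) \<longlongrightarrow> a ^ k) F"
  by (induction k) (auto intro: tendsto_mult_fps assms)

lemma tendsto_minus_fps:
  fixes a b :: "'a::comm_ring_1 fps"
  assumes "(f \<longlongrightarrow> a) F" "(g \<longlongrightarrow> b) F"
  shows "((\<lambda>x. f x - g x) \<longlongrightarrow> a - b) F"
proof (rule tendsto_fpsI)
  fix n
  from assms have "eventually (\<lambda>x. f x $ n = a $ n) F" "eventually (\<lambda>x. g x $ n = b $ n) F"
    by (auto simp: tendsto_fps_iff)
  then show "eventually (\<lambda>x. (f x - g x) $ n = (a - b) $ n) F"
    by eventually_elim auto
qed

lemma tendsto_add_fps:
  fixes a b :: "'a::comm_ring_1 fps"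
  assumes "(f \<longlongrightarrow> a) F" "(g \<longlongrightarrow> b) F"
  shows "((\<lambda>x. f x + g x) \<longlongrightarrow> a + b) F"
proof (rule tendsto_fpsI)
  fix n
  from assms have "eventually (\<lambda>x. f x $ n = a $ n) F" "eventually (\<lambda>x. g x $ n = b $ n) F"
    by (auto simp: tendsto_fps_iff)
  then show "eventually (\<lambda>x. (f x + g x) $ n = (a + b) $ n) F"
    by eventually_elim auto
qed

text \<open>Truncation errors are treated as congruences modulo a power of q, so that they pass
  through products and units by ring reasoning.\<close>

lemma fps_X_power_dvd_iff:
  fixes f :: "'a::comm_ring_1 fps"
  shows "fps_X ^ n dvd f \<longleftrightarrow> (\<forall>i<n. f $ i = 0)"
proof
  assume "fps_X ^ n dvd f"
  then show "\<forall>i<n. f $ i = 0" by (auto elim!: dvdE simp: fps_X_power_mult_nth)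
next
  assume "\<forall>i<n. f $ i = 0"
  then have "f = fps_X ^ n * fps_shift n f"
    by (auto simp: fps_eq_iff fps_X_power_mult_nth)
  then show "fps_X ^ n dvd f" by (rule dvdI)
qed

lemma cong_mult_dvd:
  fixes a b :: "'a::comm_ring_1"
  assumes "m dvd a - a'" "m dvd b - b'"
  shows "m dvd a * b - a' * b'"
proof -
  have "a * b - a' * b' = a * (b - b') + (a - a') * b'" by (simp add: algebra_simps)
  with assms show ?thesis by simp
qed

section \<open>Infinite products (-e q^r; q^d) as coefficientwise limits\<close>

definition qprod_fin :: "rat \<Rightarrow> nat \<Rightarrow> nat \<Rightarrow> nat \<Rightarrow> rat fps" where
  "qprod_fin e r d N = (\<Prod>i<N. 1 + fps_const e * fps_X ^ (r + d * i))"

text \<open>For positive r and d the factors with i > m have exponents above m, so coefficient m is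
  final once m + 1 factors are taken.\<close>

definition qprod :: "rat \<Rightarrow> nat \<Rightarrow> nat \<Rightarrow> rat fps" where
  "qprod e r d = Abs_fps (\<lambda>m. qprod_fin e r d (Suc m) $ m)"

lemma qprod_fin_0 [simp]: "qprod_fin e r d 0 = 1"
  and qprod_fin_Suc [simp]:
    "qprod_fin e r d (Suc N) = qprod_fin e r d N * (1 + fps_const e * fps_X ^ (r + d * N))"
  by (simp_all add: qprod_fin_def)

lemma qprod_fin_nth:
  assumes "r > 0" "d > 0" "m < r + d * N"
  shows "qprod_fin e r d N $ m = qprod e r d $ m"
proof -
  have stable: "qprod_fin e r d (M + j) $ m = qprod_fin e r d M $ m" if M: "m < r + d * M" for M j
  proof (induction j)
    case (Suc j)
    have "m < r + d * (M + j)" using M by (simp add: distrib_left)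
    then have "(qprod_fin e r d (M + j) * fps_X ^ (r + d * (M + j)) * fps_const e) $ m = 0"
      by (simp add: fps_X_power_mult_right_nth)
    then have "qprod_fin e r d (Suc (M + j)) $ m = qprod_fin e r d (M + j) $ m"
      by (subst qprod_fin_Suc) (simp add: algebra_simps)
    with Suc show ?case by simp
  qed simp
  have "m < d * Suc m" using assms(2) by (cases d) auto
  then have "m < r + d * Suc m" by simp
  from stable[OF assms(3), of "Suc m"] stable[OF this, of N] show ?thesis
    by (simp add: qprod_def add.commute del: qprod_fin_Suc)
qed

lemma qprod_tendsto:
  assumes "r > 0" "d > 0"
  shows "(\<lambda>N. qprod_fin e r d N) \<longlonglongrightarrow> qprod e r d"
proof (rule tendsto_fpsI)
  fix n
  have "n < r + d * N" if "n < N" for N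
  proof -
    have "N \<le> d * N" using assms(2) by (cases d) auto
    with that show ?thesis by linarith
  qed
  then show "eventually (\<lambda>N. qprod_fin e r d N $ n = qprod e r d $ n) sequentially"
    by (intro eventually_mono[OF eventually_gt_at_top[of n]] qprod_fin_nth assms)
qed

lemma qprod_fin_cong:
  assumes "r > 0" "d > 0" "L \<le> Suc N"
  shows "fps_X ^ L dvd qprod_fin e r d N - qprod e r d"
proof -
  have "m < r + d * N" if "m < L" for m
  proof -
    have "N \<le> d * N" using assms(2) by (cases d) auto
    with that assms show ?thesis by linarith
  qed
  then show ?thesis using assms by (auto simp: fps_X_power_dvd_iff qprod_fin_nth)
qed

lemma qprod_nth_0: "r > 0 \<Longrightarrow> qprod e r d $ 0 = 1"
  by (simp add: qprod_def qprod_fin_def)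

lemma filterlim_mult_sequentially: "k > 0 \<Longrightarrow> filterlim (\<lambda>N. k * N :: nat) sequentially sequentially"
  by (intro filterlim_subseq strict_monoI) auto

text \<open>The identity is exact between 2N factors on one side and N + N on the other; uniqueness
  of limits along the subsequence 2N then replaces any rearrangement of infinite products. The same
  scheme serves the later product identities.\<close>

lemma qprod_dissect_2:
  assumes "r > 0" "d > 0"
  shows "qprod e r d = qprod e r (2 * d) * qprod e (r + d) (2 * d)"
proof (rule LIMSEQ_unique)
  show "(\<lambda>N. qprod_fin e r d (2 * N)) \<longlonglongrightarrow> qprod e r d"
    by (rule filterlim_compose[OF qprod_tendsto filterlim_mult_sequentially]) (use assms in auto)
  have "qprod_fin e r d (2 * N) = qprod_fin e r (2 * d) N * qprod_fin e (r + d) (2 * d) N" for N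
    by (induction N) (simp_all add: algebra_simps)
  then show "(\<lambda>N. qprod_fin e r d (2 * N)) \<longlonglongrightarrow> qprod e r (2 * d) * qprod e (r + d) (2 * d)"
    using assms by (simp add: tendsto_mult_fps qprod_tendsto)
qed

lemma qprod_dissect_3:
  assumes "r > 0" "d > 0"
  shows "qprod e r d = qprod e r (3 * d) * qprod e (r + d) (3 * d) * qprod e (r + 2 * d) (3 * d)"
proof (rule LIMSEQ_unique)
  show "(\<lambda>N. qprod_fin e r d (3 * N)) \<longlonglongrightarrow> qprod e r d"
    by (rule filterlim_compose[OF qprod_tendsto filterlim_mult_sequentially]) (use assms in auto)
  have "qprod_fin e r d (3 * N) = qprod_fin e r (3 * d) N * qprod_fin e (r + d) (3 * d) N
          * qprod_fin e (r + 2 * d) (3 * d) N" for N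
  proof (induction N)
    case (Suc N)
    have "qprod_fin e r d (3 * Suc N) = qprod_fin e r d (3 * N) * (1 + fps_const e * fps_X ^ (r + d * (3 * N)))
       * (1 + fps_const e * fps_X ^ (r + d * (3 * N + 1))) * (1 + fps_const e * fps_X ^ (r + d * (3 * N + 2)))"
      by (simp add: numeral_3_eq_3)
    then show ?case
      unfolding Suc.IH by (simp add: add_mult_distrib2 add.assoc mult_ac add_ac)
  qed simp
  then show "(\<lambda>N. qprod_fin e r d (3 * N)) \<longlonglongrightarrow>
      qprod e r (3 * d) * qprod e (r + d) (3 * d) * qprod e (r + 2 * d) (3 * d)"
    using assms by (simp add: tendsto_mult_fps qprod_tendsto)
qed

lemma qprod_plus_minus:
  assumes "r > 0" "d > 0"
  shows "qprod 1 r d * qprod (-1) r d = qprod (-1) (2 * r) (2 * d)"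
proof (rule LIMSEQ_unique)
  have "(1 + fps_X ^ m) * (1 + fps_const (-1) * fps_X ^ m) = 1 + fps_const (-1) * (fps_X ^ (2 * m) :: rat fps)" for m
    by (simp add: mult_2 power_add ring_distribs flip: fps_const_neg)
  then have "qprod_fin 1 r d N * qprod_fin (-1) r d N = qprod_fin (-1) (2 * r) (2 * d) N" for N
    unfolding qprod_fin_def prod.distrib[symmetric] by (intro prod.cong) (simp_all add: algebra_simps)
  then show "(\<lambda>N. qprod_fin (-1) (2 * r) (2 * d) N) \<longlonglongrightarrow> qprod 1 r d * qprod (-1) r d"
    using tendsto_mult_fps[OF qprod_tendsto[OF assms, of 1] qprod_tendsto[OF assms, of "-1"]] by simp
  show "(\<lambda>N. qprod_fin (-1) (2 * r) (2 * d) N) \<longlonglongrightarrow> qprod (-1) (2 * r) (2 * d)"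
    using assms by (simp add: qprod_tendsto)
qed

subsection \<open>The Jacobi triple product\<close>

text \<open>Defined by the q-Pascal rule instead of a quotient of q-factorials, so that it lives in
  any commutative ring; the quotient formula appears multiplied out in
  \<open>gauss_binomial_qfact\<close>.\<close>

fun gauss_binomial :: "'a::comm_ring_1 \<Rightarrow> nat \<Rightarrow> nat \<Rightarrow> 'a" where
  "gauss_binomial Q M 0 = 1"
| "gauss_binomial Q 0 (Suc k) = 0"
| "gauss_binomial Q (Suc M) (Suc k) = gauss_binomial Q M k + Q ^ Suc k * gauss_binomial Q M (Suc k)"

lemma gauss_binomial_eq_0: "k > M \<Longrightarrow> gauss_binomial Q M k = 0"
  by (induction Q M k rule: gauss_binomial.induct) auto

lemma gauss_binomial_qfact:
  assumes "k \<le> M"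
  shows "gauss_binomial Q M k * (\<Prod>i<k. 1 - Q ^ Suc i) * (\<Prod>i<M - k. 1 - Q ^ Suc i)
           = (\<Prod>i<M. 1 - Q ^ Suc i)"
  using assms
proof (induction Q M k rule: gauss_binomial.induct)
  case (3 Q M k)
  let ?q = "\<lambda>n. \<Prod>i<n. 1 - Q ^ Suc i"
  have 1: "gauss_binomial Q M k * ?q k * ?q (M - k) = ?q M" using 3 by simp
  have 2: "Q ^ Suc k * gauss_binomial Q M (Suc k) * ?q (Suc k) * ?q (M - k)
       = ?q M * (Q ^ Suc k - Q ^ Suc M)"
  proof (cases "k = M")
    case True
    then show ?thesis by (simp add: gauss_binomial_eq_0)
  next
    case False
    then have k: "Suc k \<le> M" using 3 by simp
    then have M: "M - k = Suc (M - Suc k)" by simp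
    have "Q ^ Suc k * gauss_binomial Q M (Suc k) * ?q (Suc k) * ?q (M - k) =
       (gauss_binomial Q M (Suc k) * ?q (Suc k) * ?q (M - Suc k)) * (Q ^ Suc k * (1 - Q ^ Suc (M - Suc k)))"
      unfolding M prod.lessThan_Suc by (simp only: mult_ac)
    also have "\<dots> = ?q M * (Q ^ Suc k - Q ^ (Suc k + Suc (M - Suc k)))"
      unfolding "3.IH"(2)[OF k] power_add by (simp only: right_diff_distrib mult_1_right)
    finally show ?thesis using k by simp
  qed
  have "gauss_binomial Q (Suc M) (Suc k) * ?q (Suc k) * ?q (Suc M - Suc k)
     = (gauss_binomial Q M k * ?q k * ?q (M - k)) * (1 - Q ^ Suc k)
       + Q ^ Suc k * gauss_binomial Q M (Suc k) * ?q (Suc k) * ?q (M - k)"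
    by (simp add: algebra_simps)
  also have "\<dots> = ?q M * (1 - Q ^ Suc k) + ?q M * (Q ^ Suc k - Q ^ Suc M)"
    unfolding 1 2 ..
  also have "\<dots> = ?q (Suc M)" by (simp add: algebra_simps)
  finally show ?case .
qed simp_all

lemma Suc_choose_2: "Suc k choose 2 = (k choose 2) + k"
  by (simp add: numeral_2_eq_2)

text \<open>The homogeneous form in x and y allows y to be a high power of q, where the usual form
  would need negative exponents of q in x. The induction splits off the factor i = 0, which replaces
  x by \<open>x * Q\<close>.\<close>

lemma gauss_binomial_theorem:
  fixes x y Q :: "'a::comm_ring_1"
  shows "(\<Prod>i<M. y + x * Q ^ i)
    = (\<Sum>k\<le>M. Q ^ (k choose 2) * gauss_binomial Q M k * x ^ k * y ^ (M - k))"
proof (induction M arbitrary: x)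
  case (Suc M)
  define c where "c = (\<lambda>k. Q ^ (k choose 2) * gauss_binomial Q M k * (x * Q) ^ k)"
  have c0: "c 0 = 1" by (simp add: c_def numeral_2_eq_2)
  have cSuc: "c (Suc M) = 0" by (simp add: c_def gauss_binomial_eq_0)
  have rec: "Q ^ (Suc k choose 2) * gauss_binomial Q (Suc M) (Suc k) * x ^ Suc k = x * c k + c (Suc k)" for k
    by (simp add: c_def Suc_choose_2 power_mult_distrib power_add algebra_simps)
  have "(\<Prod>i<Suc M. y + x * Q ^ i) = (y + x) * (\<Prod>i<M. y + x * Q * Q ^ i)"
    by (subst prod.lessThan_Suc_shift) (simp add: mult.assoc)
  also have "\<dots> = (y + x) * (\<Sum>k\<le>M. c k * y ^ (M - k))"
    unfolding Suc.IH c_def ..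
  also have "\<dots> = (\<Sum>k\<le>M. x * c k * y ^ (M - k)) + (\<Sum>k\<le>M. c k * y ^ (Suc M - k))"
    by (simp add: sum_distrib_left sum.distrib Suc_diff_le algebra_simps
          del: power_Suc) (simp add: mult_ac)
  also have "(\<Sum>k\<le>M. c k * y ^ (Suc M - k)) = (\<Sum>k\<le>Suc M. c k * y ^ (Suc M - k))"
    by (simp add: cSuc)
  also have "\<dots> = y ^ Suc M + (\<Sum>k\<le>M. c (Suc k) * y ^ (M - k))"
    by (subst sum.atMost_Suc_shift) (simp add: c0)
  also have "(\<Sum>k\<le>M. x * c k * y ^ (M - k)) + (y ^ Suc M + (\<Sum>k\<le>M. c (Suc k) * y ^ (M - k)))
     = y ^ Suc M + (\<Sum>k\<le>M. (x * c k + c (Suc k)) * y ^ (M - k))"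
    by (simp add: sum.distrib distrib_right)
  also have "\<dots> = (\<Sum>k\<le>Suc M. Q ^ (k choose 2) * gauss_binomial Q (Suc M) k * x ^ k * y ^ (Suc M - k))"
    by (subst sum.atMost_Suc_shift) (simp add: rec[symmetric] numeral_2_eq_2
        del: gauss_binomial.simps(3) power_Suc binomial_Suc_Suc)
  finally show ?case .
qed (simp add: numeral_2_eq_2)

text \<open>The bilateral series over all integers n of c(n) q^E(n). It is faithful only when every
  fibre of E is finite, since a sum over an infinite set is 0 by convention.\<close>

definition int_theta :: "(int \<Rightarrow> rat) \<Rightarrow> (int \<Rightarrow> nat) \<Rightarrow> rat fps" where
  "int_theta c E = Abs_fps (\<lambda>m. \<Sum>n | E n = m. c n)"

text \<open>The exponent of q in a^(n(n+1)/2) b^(n(n-1)/2) at a = q^r, b = q^s.\<close>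

definition theta_exp :: "nat \<Rightarrow> nat \<Rightarrow> int \<Rightarrow> nat" where
  "theta_exp r s n = nat ((int r * (n * (n + 1)) + int s * (n * (n - 1))) div 2)"

lemma theta_exp_nonneg: "0 \<le> int r * (n * (n + 1)) + int s * (n * (n - 1))"
proof -
  have "0 \<le> n * (n + 1)" "0 \<le> n * (n - 1)" by (auto simp: zero_le_mult_iff)
  then show ?thesis by simp
qed

lemma two_theta_exp:
  "2 * int (theta_exp r s n) = int r * (n * (n + 1)) + int s * (n * (n - 1))"
proof -
  have "even (int r * (n * (n + 1)) + int s * (n * (n - 1)))" by auto
  moreover have "0 \<le> (int r * (n * (n + 1)) + int s * (n * (n - 1))) div 2"
    using theta_exp_nonneg[of r n s] by (simp only: pos_imp_zdiv_nonneg_iff)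
  ultimately show ?thesis unfolding theta_exp_def by (simp only: int_nat_eq if_True dvd_mult_div_cancel)
qed

text \<open>Confines the indices contributing to coefficient m to the interval from -m to m. This
  gives both finite fibres and a threshold for N in the limit of the finite triple product.\<close>

lemma abs_le_theta_exp:
  assumes "r > 0" "s > 0"
  shows "\<bar>n\<bar> \<le> int (theta_exp r s n)"
proof -
  have a: "0 \<le> n * (n + 1)" "0 \<le> n * (n - 1)" by (auto simp: zero_le_mult_iff)
  have "\<bar>n\<bar> \<le> \<bar>n\<bar> * \<bar>n\<bar>"
    using mult_left_mono[of 1 "\<bar>n\<bar>" "\<bar>n\<bar>"] by (cases "n = 0") simp_all
  then have "2 * \<bar>n\<bar> \<le> 2 * (n * n)" by simp
  also have "\<dots> = n * (n + 1) + n * (n - 1)" by (simp add: algebra_simps)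
  also have "\<dots> \<le> int r * (n * (n + 1)) + int s * (n * (n - 1))"
    using assms a by (intro add_mono mult_le_cancel_right1[THEN iffD2]) auto
  finally show ?thesis unfolding two_theta_exp[symmetric] by simp
qed

lemma two_choose_2: "2 * int (k choose 2) = int k * (int k - 1)"
  by (induction k) (simp_all add: Suc_choose_2 algebra_simps)

lemma prod_power_X:
  "(\<Prod>i<N. fps_X ^ (r + d * i) :: 'a::comm_ring_1 fps) = fps_X ^ (N * r + d * (N choose 2))"
  by (induction N) (simp_all add: Suc_choose_2 power_add algebra_simps binomial_eq_0)

text \<open>Specialise the Gauss binomial theorem to \<open>M = 2N\<close>, \<open>y = Q\<^sup>N\<close> and cancel a common monomial.\<close>

lemma finite_triple_product:
  fixes e :: rat
  assumes e: "e * e = 1" and d: "d = r + s" and "r > 0" "s > 0"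
  shows "qprod_fin e r d N * qprod_fin e s d N =
    (\<Sum>k\<le>2*N. gauss_binomial (fps_X ^ d) (2 * N) k *
       (fps_const (e ^ nat \<bar>int k - int N\<bar>) * fps_X ^ theta_exp r s (int k - int N)))"
    (is "_ = ?rhs")
proof -
  let ?Q = "fps_X ^ d :: rat fps"
  \<comment> \<open>The monomial taken out: each of the first N factors gives up e q^(r+di), using e
    * e = 1, and each of the last N gives up y.\<close>
  define C where "C = fps_const (e ^ N) * fps_X ^ (N * r + d * (N choose 2) + d * N * N)"
  have e0: "e \<noteq> 0" using e by auto
  have "C \<noteq> 0" unfolding C_def using e0 by simp
  define y where "y = (fps_X ^ (d * N) :: rat fps)"
  define x where "x = fps_const e * (fps_X ^ r :: rat fps)"
  have 1: "(\<Prod>i<N. y + x * ?Q ^ i) = fps_const (e ^ N) * fps_X ^ (N * r + d * (N choose 2)) * qprod_fin e s d N"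
  proof -
    have "y + x * ?Q ^ i = (fps_const e * fps_X ^ (r + d * i)) * (1 + fps_const e * fps_X ^ (s + d * (N - Suc i)))"
      if "i < N" for i
    proof -
      have "r + d * i + (s + d * (N - Suc i)) = d * (i + Suc (N - Suc i))"
        unfolding d by (simp add: algebra_simps)
      also have "i + Suc (N - Suc i) = N" using that by simp
      finally have *: "fps_X ^ (r + d * i) * fps_X ^ (s + d * (N - Suc i)) = y"
        unfolding y_def by (simp flip: power_add)
      have "(fps_const e * fps_X ^ (r + d * i)) * (1 + fps_const e * fps_X ^ (s + d * (N - Suc i)))
         = fps_const e * fps_X ^ (r + d * i) + fps_const (e * e) * (fps_X ^ (r + d * i) * fps_X ^ (s + d * (N - Suc i)))"
        by (simp add: algebra_simps flip: fps_const_mult)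
      then show ?thesis unfolding * e by (simp add: x_def power_add mult.assoc flip: power_mult)
    qed
    then have "(\<Prod>i<N. y + x * ?Q ^ i) = (\<Prod>i<N. fps_const e * fps_X ^ (r + d * i)) *
        (\<Prod>i<N. 1 + fps_const e * fps_X ^ (s + d * (N - Suc i)))"
      by (simp flip: prod.distrib)
    also have "(\<Prod>i<N. 1 + fps_const e * fps_X ^ (s + d * (N - Suc i))) = qprod_fin e s d N"
      unfolding qprod_fin_def by (rule prod.nat_diff_reindex)
    finally show ?thesis by (simp add: prod.distrib prod_power_X fps_const_power)
  qed
  have 2: "(\<Prod>i<N. y + x * ?Q ^ (i + N)) = fps_X ^ (d * N * N) * qprod_fin e r d N"
  proof -
    have "y + x * ?Q ^ (i + N) = y * (1 + fps_const e * fps_X ^ (r + d * i))" for i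
      by (simp add: y_def x_def power_add algebra_simps flip: power_mult)
    then show ?thesis by (simp add: prod.distrib qprod_fin_def y_def flip: power_mult)
  qed
  have "C * (qprod_fin e r d N * qprod_fin e s d N) = (\<Prod>i<N. y + x * ?Q ^ i) * (\<Prod>i<N. y + x * ?Q ^ (i + N))"
    unfolding 1 2 C_def by (simp add: power_add algebra_simps)
  also have "\<dots> = (\<Prod>i<2 * N. y + x * ?Q ^ i)"
  proof -
    have "(\<Prod>i<N. f i) * (\<Prod>i<K. f (i + N)) = (\<Prod>i<K + N. f i)" for f :: "nat \<Rightarrow> rat fps" and K
      by (induction K) (simp_all add: mult_ac)
    then show ?thesis by (simp add: mult_2)
  qed
  also have "\<dots> = (\<Sum>k\<le>2*N. ?Q ^ (k choose 2) * gauss_binomial ?Q (2 * N) k * x ^ k * y ^ (2 * N - k))"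
    by (rule gauss_binomial_theorem)
  also have "\<dots> = C * ?rhs"
    unfolding sum_distrib_left
  proof (rule sum.cong)
    fix k assume "k \<in> {..2 * N}"
    then have k: "k \<le> 2 * N" by simp
    define n where "n = int k - int N"
    \<comment> \<open>Doubling turns the binomials and \<open>theta_exp\<close> into polynomials
      over the integers.\<close>
    have "2 * int (d * (k choose 2) + r * k + d * N * (2 * N - k))
        = int d * (2 * int (k choose 2)) + 2 * int r * int k + 2 * int d * int N * (2 * int N - int k)"
      using k by (simp add: of_nat_diff ring_distribs)
    also have "\<dots> = 2 * int N * int r + int d * (2 * int (N choose 2)) + 2 * int d * int N * int N
        + 2 * int (theta_exp r s n)"
      unfolding two_choose_2 two_theta_exp d n_def of_nat_add by (simp add: algebra_simps)
    also have "\<dots> = 2 * int (N * r + d * (N choose 2) + d * N * N + theta_exp r s n)"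
      by (simp add: ring_distribs)
    finally have *: "d * (k choose 2) + r * k + d * N * (2 * N - k) = N * r + d * (N choose 2) + d * N * N + theta_exp r s n"
      by (simp only: mult_cancel_left of_nat_eq_iff) simp
    have **: "e ^ k = e ^ N * e ^ nat \<bar>n\<bar>"
    proof (cases "k \<ge> N")
      case True
      then show ?thesis by (simp add: n_def nat_diff_distrib flip: power_add)
    next
      case False
      then have "N + nat \<bar>n\<bar> = k + 2 * (N - k)" by (simp add: n_def)
      then have "e ^ N * e ^ nat \<bar>n\<bar> = e ^ k * (e * e) ^ (N - k)"
        by (metis power_add power_mult power2_eq_square)
      then show ?thesis by (simp add: e)
    qed
    have "?Q ^ (k choose 2) * gauss_binomial ?Q (2 * N) k * x ^ k * y ^ (2 * N - k)
      = gauss_binomial ?Q (2 * N) k * fps_const (e ^ k) * fps_X ^ (d * (k choose 2) + r * k + d * N * (2 * N - k))"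
      unfolding x_def y_def power_add power_mult by (simp add: power_mult_distrib mult_ac flip: fps_const_power)
    then show "?Q ^ (k choose 2) * gauss_binomial ?Q (2 * N) k * x ^ k * y ^ (2 * N - k)
      = C * (gauss_binomial ?Q (2 * N) k * (fps_const (e ^ nat \<bar>int k - int N\<bar>) * fps_X ^ theta_exp r s (int k - int N)))"
      unfolding * ** C_def by (simp add: power_add n_def mult_ac flip: fps_const_mult)
  qed simp
  finally show ?thesis using \<open>C \<noteq> 0\<close> by simp
qed

text \<open>Modulo q^L the three q-factorials of lengths k, M - k and M all agree with the infinite
  product P. The quotient formula becomes G P P = P, and P is a unit.\<close>

lemma gauss_binomial_limit:
  assumes "d > 0" "j < L" "L \<le> Suc k" "L \<le> Suc (M - k)" "k \<le> M"
  shows "(gauss_binomial (fps_X ^ d) M k * qprod (-1) d d) $ j = (if j = 0 then 1 else 0)"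
proof -
  let ?P = "qprod (-1) d d" and ?G = "gauss_binomial (fps_X ^ d) M k :: rat fps"
  have fin: "(\<Prod>i<n. 1 - (fps_X ^ d :: rat fps) ^ Suc i) = qprod_fin (-1) d d n" for n
    unfolding qprod_fin_def by (intro prod.cong) (simp_all add: power_add flip: power_mult fps_const_neg)
  have c: "fps_X ^ L dvd qprod_fin (-1) d d n - ?P" if "L \<le> Suc n" for n
    using that assms(1) by (intro qprod_fin_cong)
  have "fps_X ^ L dvd ?G * qprod_fin (-1) d d k * qprod_fin (-1) d d (M - k) - ?G * ?P * ?P"
    by (intro cong_mult_dvd c assms) simp
  moreover have "?G * qprod_fin (-1) d d k * qprod_fin (-1) d d (M - k) = qprod_fin (-1) d d M"
    using gauss_binomial_qfact[OF assms(5), of "fps_X ^ d :: rat fps"] unfolding fin .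
  ultimately have 1: "fps_X ^ L dvd qprod_fin (-1) d d M - ?G * ?P * ?P" by simp
  have 2: "fps_X ^ L dvd qprod_fin (-1) d d M - ?P" using assms by (intro c) auto
  have "fps_X ^ L dvd (qprod_fin (-1) d d M - ?P) - (qprod_fin (-1) d d M - ?G * ?P * ?P)"
    by (rule dvd_diff[OF 2 1])
  then have "fps_X ^ L dvd (?G * ?P - 1) * ?P" by (simp add: algebra_simps)
  then have "fps_X ^ L dvd (?G * ?P - 1) * ?P * inverse ?P" by (rule dvd_mult2)
  moreover have "?P * inverse ?P = 1"
    using assms(1) by (intro inverse_mult_eq_1') (simp add: qprod_nth_0)
  ultimately have "fps_X ^ L dvd ?G * ?P - 1" by (simp add: mult.assoc)
  with assms(2) show ?thesis by (simp add: fps_X_power_dvd_iff)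
qed

text \<open>The sign is written with the exponent |n| because e * e = 1 makes it equal to e^(n^2),
  the sign of Ramanujan's series at a = e q^r, b = e q^s.\<close>

theorem triple_product:
  fixes e :: rat
  assumes e: "e * e = 1" and d: "d = r + s" and rs: "r > 0" "s > 0"
  shows "qprod e r d * qprod e s d * qprod (-1) d d = int_theta (\<lambda>n. e ^ nat \<bar>n\<bar>) (theta_exp r s)"
    (is "?L = ?R")
proof (rule LIMSEQ_unique)
  let ?f = "\<lambda>N. qprod_fin e r d N * qprod_fin e s d N * qprod (-1) d d"
  have d0: "d > 0" using d rs by simp
  show "?f \<longlonglongrightarrow> ?L"
    by (intro tendsto_mult_fps qprod_tendsto tendsto_const d0 rs)
  show "?f \<longlonglongrightarrow> ?R"
  proof (rule tendsto_fpsI)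
    fix m
    \<comment> \<open>Only |n| at most m matters; with N at least 2m, both k = N + n and 2N - k are
      then at least m, as \<open>gauss_binomial_limit\<close> with L = m + 1 requires.\<close>
    have "?f N $ m = ?R $ m" if N: "N \<ge> 2 * m" for N
    proof -
      let ?E = "theta_exp r s" and ?c = "\<lambda>n::int. e ^ nat \<bar>n\<bar>"
      have "?f N = (\<Sum>k\<le>2*N. (gauss_binomial (fps_X ^ d) (2 * N) k * qprod (-1) d d) *
               (fps_const (?c (int k - int N)) * fps_X ^ ?E (int k - int N)))"
        unfolding finite_triple_product[OF assms] sum_distrib_right by (simp add: mult_ac)
      also have "\<dots> $ m = (\<Sum>k\<le>2*N. if ?E (int k - int N) = m then ?c (int k - int N) else 0)"
        unfolding fps_sum_nth
      proof (rule sum.cong)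
        fix k assume "k \<in> {..2 * N}"
        then have k: "k \<le> 2 * N" by simp
        let ?n = "int k - int N" and ?G = "gauss_binomial (fps_X ^ d) (2 * N) k * qprod (-1) d d"
        have "(?G * (fps_const (?c ?n) * fps_X ^ ?E ?n)) $ m =
              (if m < ?E ?n then 0 else ?c ?n * ?G $ (m - ?E ?n))"
        proof -
          have "?G * (fps_const (?c ?n) * fps_X ^ ?E ?n) = fps_const (?c ?n) * ?G * fps_X ^ ?E ?n"
            by (simp add: mult_ac)
          then show ?thesis by (simp only: fps_X_power_mult_right_nth fps_mult_left_const_nth)
        qed
        also have "\<dots> = (if ?E ?n = m then ?c ?n else 0)"
        proof (cases "?E ?n \<le> m")
          case True
          have "\<bar>?n\<bar> \<le> int m" using abs_le_theta_exp[OF rs, of ?n] True by linarith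
          then have "?G $ (m - ?E ?n) = (if m - ?E ?n = 0 then 1 else 0)"
            using N k by (intro gauss_binomial_limit[of _ _ "Suc m"] d0) linarith+
          with True show ?thesis by simp
        qed simp
        finally show "(?G * (fps_const (?c ?n) * fps_X ^ ?E ?n)) $ m = (if ?E ?n = m then ?c ?n else 0)" .
      qed simp
      also have "\<dots> = (\<Sum>k | k \<le> 2 * N \<and> ?E (int k - int N) = m. ?c (int k - int N))"
        by (simp add: sum.If_cases Int_def)
      also have "\<dots> = (\<Sum>n | ?E n = m. ?c n)"
      proof (rule sum.reindex_bij_witness[of _ "\<lambda>n. nat (n + int N)" "\<lambda>k. int k - int N"])
        fix n assume "n \<in> {n. ?E n = m}"
        then have "\<bar>n\<bar> \<le> int m" using abs_le_theta_exp[OF rs, of n] by simp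
        then have n: "0 \<le> n + int N" "n \<le> int N" using N by linarith+
        then show "int (nat (n + int N)) - int N = n" by simp
        with n \<open>n \<in> _\<close> show "nat (n + int N) \<in> {k. k \<le> 2 * N \<and> ?E (int k - int N) = m}" by simp
      qed auto
      finally show ?thesis by (simp add: int_theta_def)
    qed
    then show "eventually (\<lambda>N. ?f N $ m = ?R $ m) sequentially"
      by (rule eventually_mono[OF eventually_ge_at_top])
  qed
qed

subsection \<open>The 3-dissection of the product of \<open>f\<^sub>1\<close> and \<open>f\<^sub>2\<close>\<close>

lemma finite_theta_exp: "r > 0 \<Longrightarrow> s > 0 \<Longrightarrow> finite {n. theta_exp r s n = m}"
  by (rule finite_subset[of _ "{- int m..int m}"])
    (auto dest: abs_le_theta_exp[of r s] simp: abs_le_iff minus_le_iff)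

lemma theta_exp_eqI:
  "2 * int k = int r * (n * (n + 1)) + int s * (n * (n - 1)) \<Longrightarrow> theta_exp r s n = k"
  using two_theta_exp[of r s n] by linarith

lemma int_theta_cong: "(\<And>n. c n = c' n) \<Longrightarrow> (\<And>n. E n = E' n) \<Longrightarrow> int_theta c E = int_theta c' E'"
  by presburger

lemma int_theta_reflect: "int_theta (\<lambda>n. c (- n)) (\<lambda>n. E (- n)) = int_theta c E"
  unfolding int_theta_def
  by (intro fps_ext) (auto intro!: sum.reindex_bij_witness[of _ uminus uminus])

lemma int_theta_shift: "int_theta c (\<lambda>n. E n + k) = fps_X ^ k * int_theta c E"
proof (rule fps_ext)
  fix m
  show "int_theta c (\<lambda>n. E n + k) $ m = (fps_X ^ k * int_theta c E) $ m"
  proof (cases "k \<le> m")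
    case True
    then have "{n. E n + k = m} = {n. E n = m - k}" by auto
    with True show ?thesis by (simp add: int_theta_def fps_X_power_mult_nth)
  next
    case False
    then have "{n. E n + k = m} = {}" by auto
    with False show ?thesis by (simp add: int_theta_def fps_X_power_mult_nth)
  qed
qed

lemma int_theta_uminus: "int_theta (\<lambda>n. - c n) E = - int_theta c E"
  by (rule fps_ext) (simp add: int_theta_def sum_negf)

lemma int_theta_compose:
  assumes "d > 0"
  shows "int_theta c (\<lambda>n. d * E n) = int_theta c E oo fps_X ^ d"
proof (rule fps_ext)
  fix m
  show "int_theta c (\<lambda>n. d * E n) $ m = (int_theta c E oo fps_X ^ d) $ m"
  proof (cases "d dvd m")
    case True
    then have "{n. d * E n = m} = {n. E n = m div d}" using assms by auto
    with True show ?thesis by (simp add: int_theta_def fps_nth_compose_X_power)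
  next
    case False
    then have "{n. d * E n = m} = {}" by auto
    with False show ?thesis by (simp add: int_theta_def fps_nth_compose_X_power)
  qed
qed

lemma int_theta_split_2:
  assumes fin: "\<And>m. finite {n. E n = m}"
  shows "int_theta c E = int_theta (\<lambda>n. c (2 * n)) (\<lambda>n. E (2 * n))
    + int_theta (\<lambda>n. c (2 * n + 1)) (\<lambda>n. E (2 * n + 1))"
proof (rule fps_ext)
  fix m
  let ?f = "\<lambda>n::int. 2 * n" and ?g = "\<lambda>n::int. 2 * n + 1"
  have eq: "{n. E n = m} = ?f ` {n. E (?f n) = m} \<union> ?g ` {n. E (?g n) = m}" (is "_ = ?A \<union> ?B")
  proof (intro set_eqI iffI)
    fix n assume n: "n \<in> {n. E n = m}"
    have "\<exists>k. n = ?f k \<or> n = ?g k" by presburger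
    then obtain k where "n = ?f k \<or> n = ?g k" ..
    with n show "n \<in> ?A \<union> ?B" by (elim disjE) auto
  qed auto
  have "?f i \<noteq> ?g j" for i j by presburger
  then have disj: "?A \<inter> ?B = {}" by blast
  have "finite ?A" "finite ?B" using fin[of m] unfolding eq by auto
  then have "sum c {n. E n = m} = sum c ?A + sum c ?B"
    unfolding eq by (rule sum.union_disjoint[OF _ _ disj])
  also have "\<dots> = (\<Sum>n | E (?f n) = m. c (?f n)) + (\<Sum>n | E (?g n) = m. c (?g n))"
    by (simp add: sum.reindex inj_on_def)
  finally show "int_theta c E $ m = (int_theta (\<lambda>n. c (?f n)) (\<lambda>n. E (?f n))
    + int_theta (\<lambda>n. c (?g n)) (\<lambda>n. E (?g n))) $ m"
    by (simp add: int_theta_def)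
qed

text \<open>The representative 3n - 1, rather than 3n + 2, lets the reflection n -> -n exchange the
  two nonzero residues.\<close>

lemma int_theta_split_3:
  assumes fin: "\<And>m. finite {n. E n = m}"
  shows "int_theta c E = int_theta (\<lambda>n. c (3 * n)) (\<lambda>n. E (3 * n))
    + int_theta (\<lambda>n. c (3 * n + 1)) (\<lambda>n. E (3 * n + 1))
    + int_theta (\<lambda>n. c (3 * n - 1)) (\<lambda>n. E (3 * n - 1))"
proof (rule fps_ext)
  fix m
  let ?f = "\<lambda>n::int. 3 * n" and ?g = "\<lambda>n::int. 3 * n + 1" and ?h = "\<lambda>n::int. 3 * n - 1"
  have eq: "{n. E n = m} = ?f ` {n. E (?f n) = m} \<union> ?g ` {n. E (?g n) = m} \<union> ?h ` {n. E (?h n) = m}"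
    (is "_ = ?A \<union> ?B \<union> ?C")
  proof (intro set_eqI iffI)
    fix n assume n: "n \<in> {n. E n = m}"
    have "\<exists>k. n = ?f k \<or> n = ?g k \<or> n = ?h k" by presburger
    then obtain k where "n = ?f k \<or> n = ?g k \<or> n = ?h k" ..
    with n show "n \<in> ?A \<union> ?B \<union> ?C" by (elim disjE) auto
  qed auto
  have "?f i \<noteq> ?g j" "?f i \<noteq> ?h j" "?g i \<noteq> ?h j" for i j by presburger+
  then have disj: "(?A \<union> ?B) \<inter> ?C = {}" "?A \<inter> ?B = {}" by blast+
  have "finite ?A" "finite ?B" "finite ?C" using fin[of m] unfolding eq by auto
  then have "sum c {n. E n = m} = sum c ?A + sum c ?B + sum c ?C"
    unfolding eq using disj by (simp add: sum.union_disjoint)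
  also have "\<dots> = (\<Sum>n | E (?f n) = m. c (?f n)) + (\<Sum>n | E (?g n) = m. c (?g n))
      + (\<Sum>n | E (?h n) = m. c (?h n))"
    by (simp add: sum.reindex inj_on_def)
  finally show "int_theta c E $ m = (int_theta (\<lambda>n. c (?f n)) (\<lambda>n. E (?f n))
    + int_theta (\<lambda>n. c (?g n)) (\<lambda>n. E (?g n)) + int_theta (\<lambda>n. c (?h n)) (\<lambda>n. E (?h n))) $ m"
    by (simp add: int_theta_def)
qed

text \<open>Ramanujan's theta function \<open>f(eq\<^sup>r, eq\<^sup>s)\<close>; in particular \<open>theta (-1) 1 1\<close> is \<open>\<phi>(-q)\<close> and
  \<open>theta 1 1 3\<close> is \<open>\<psi>(q)\<close>.\<close>

definition theta :: "rat \<Rightarrow> nat \<Rightarrow> nat \<Rightarrow> rat fps" where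
  "theta e r s = int_theta (\<lambda>n. e ^ nat \<bar>n\<bar>) (theta_exp r s)"

lemma minus_one_power_nat_abs: "(-1 :: rat) ^ nat \<bar>n\<bar> = (if even n then 1 else -1)"
  by (auto simp: even_nat_iff uminus_power_if)

text \<open>Here the exponent is n^2. Residue 0 reproduces the series at q^9; residues 1 and -1
  coincide by reflection, whence the factor 2, and the change of parity from n to 3n - 1 gives the
  minus sign.\<close>

lemma phi_dissection:
  "theta (-1) 1 1 = (theta (-1) 1 1 oo fps_X ^ 9) - 2 * fps_X * (theta (-1) 1 5 oo fps_X ^ 3)"
proof -
  let ?c = "\<lambda>n::int. (-1::rat) ^ nat \<bar>n\<bar>"
  have e0: "theta_exp 1 1 (3 * n) = 9 * theta_exp 1 1 n" for n
    using two_theta_exp[of 1 1 n] by (intro theta_exp_eqI) (simp add: algebra_simps)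
  have e1: "theta_exp 1 1 (3 * n - 1) = 3 * theta_exp 1 5 n + 1" for n
    using two_theta_exp[of 1 5 n] by (intro theta_exp_eqI) (simp add: algebra_simps)
  have e2: "theta_exp 1 1 (3 * n + 1) = theta_exp 1 1 (3 * (- n) - 1)" for n
    using two_theta_exp[of 1 1 "3 * (- n) - 1"] by (intro theta_exp_eqI) (simp add: algebra_simps)
  have "int_theta (\<lambda>n. ?c (3 * n)) (\<lambda>n. theta_exp 1 1 (3 * n)) = int_theta ?c (\<lambda>n. 9 * theta_exp 1 1 n)"
    by (rule int_theta_cong)
       (simp add: minus_one_power_nat_abs, rule e0)
  also have "\<dots> = theta (-1) 1 1 oo fps_X ^ 9" by (simp add: int_theta_compose theta_def)
  finally have 0: "int_theta (\<lambda>n. ?c (3 * n)) (\<lambda>n. theta_exp 1 1 (3 * n)) = theta (-1) 1 1 oo fps_X ^ 9" .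
  have "int_theta (\<lambda>n. ?c (3 * n - 1)) (\<lambda>n. theta_exp 1 1 (3 * n - 1))
      = int_theta (\<lambda>n. - ?c n) (\<lambda>n. 3 * theta_exp 1 5 n + 1)"
    by (rule int_theta_cong)
       (simp add: minus_one_power_nat_abs, rule e1)
  also have "\<dots> = - (fps_X * (theta (-1) 1 5 oo fps_X ^ 3))"
    by (simp only: int_theta_uminus int_theta_shift) (simp add: int_theta_compose theta_def)
  finally have 1: "int_theta (\<lambda>n. ?c (3 * n - 1)) (\<lambda>n. theta_exp 1 1 (3 * n - 1))
      = - (fps_X * (theta (-1) 1 5 oo fps_X ^ 3))" .
  have "int_theta (\<lambda>n. ?c (3 * n + 1)) (\<lambda>n. theta_exp 1 1 (3 * n + 1))
      = int_theta (\<lambda>n. ?c (3 * (- n) - 1)) (\<lambda>n. theta_exp 1 1 (3 * (- n) - 1))"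
    by (rule int_theta_cong)
       (simp add: minus_one_power_nat_abs, rule e2)
  also have "\<dots> = int_theta (\<lambda>n. ?c (3 * n - 1)) (\<lambda>n. theta_exp 1 1 (3 * n - 1))"
    by (rule int_theta_reflect)
  finally have 2: "int_theta (\<lambda>n. ?c (3 * n + 1)) (\<lambda>n. theta_exp 1 1 (3 * n + 1))
      = - (fps_X * (theta (-1) 1 5 oo fps_X ^ 3))" unfolding 1 .
  show ?thesis
    unfolding theta_def[of _ 1 1] by (subst int_theta_split_3[OF finite_theta_exp])
      (simp_all only: 0 1 2 theta_def[of _ 1 1], simp_all)
qed

text \<open>Here the exponent is 2n^2 - n. Residue 1 reproduces the series at q^9 up to q, while
  residues 0 and -1 are the even and odd terms of f(q, q^2) at q^3.\<close>

lemma psi_dissection: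
  "theta 1 1 3 = (theta 1 1 2 oo fps_X ^ 3) + fps_X * (theta 1 1 3 oo fps_X ^ 9)"
proof -
  have A: "theta 1 1 2 = int_theta (\<lambda>n. 1) (\<lambda>n. theta_exp 1 2 (2 * n)) + int_theta (\<lambda>n. 1) (\<lambda>n. theta_exp 1 2 (2 * n + 1))"
    unfolding theta_def by (subst int_theta_split_2[OF finite_theta_exp]) simp_all
  have e0: "theta_exp 1 3 (3 * n) = 3 * theta_exp 1 2 (2 * n)" for n
    using two_theta_exp[of 1 2 "2 * n"] by (intro theta_exp_eqI) (simp add: algebra_simps)
  have e1: "theta_exp 1 3 (3 * n - 1) = 3 * theta_exp 1 2 (2 * (- n) + 1)" for n
    using two_theta_exp[of 1 2 "2 * (- n) + 1"] by (intro theta_exp_eqI) (simp add: algebra_simps)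
  have e2: "theta_exp 1 3 (3 * n + 1) = 9 * theta_exp 1 3 (- n) + 1" for n
    using two_theta_exp[of 1 3 "- n"] by (intro theta_exp_eqI) (simp add: algebra_simps)
  have "int_theta (\<lambda>n. 1) (\<lambda>n. theta_exp 1 3 (3 * n)) = int_theta (\<lambda>n. 1) (\<lambda>n. 3 * theta_exp 1 2 (2 * n))"
    by (simp only: e0)
  then have 0: "int_theta (\<lambda>n. 1) (\<lambda>n. theta_exp 1 3 (3 * n))
      = int_theta (\<lambda>n. 1) (\<lambda>n. theta_exp 1 2 (2 * n)) oo fps_X ^ 3"
    by (simp add: int_theta_compose)
  have "int_theta (\<lambda>n. 1) (\<lambda>n. theta_exp 1 3 (3 * n - 1))
      = int_theta (\<lambda>n. 1) (\<lambda>n. 3 * theta_exp 1 2 (2 * (- n) + 1))"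
    by (simp only: e1)
  also have "\<dots> = int_theta (\<lambda>n. 1) (\<lambda>n. 3 * theta_exp 1 2 (2 * n + 1))"
    by (rule int_theta_reflect[where c = "\<lambda>n. 1"])
  finally have 1: "int_theta (\<lambda>n. 1) (\<lambda>n. theta_exp 1 3 (3 * n - 1))
      = int_theta (\<lambda>n. 1) (\<lambda>n. theta_exp 1 2 (2 * n + 1)) oo fps_X ^ 3"
    by (simp add: int_theta_compose)
  have "int_theta (\<lambda>n. 1) (\<lambda>n. theta_exp 1 3 (3 * n + 1)) = int_theta (\<lambda>n. 1) (\<lambda>n. 9 * theta_exp 1 3 (- n) + 1)"
    by (simp only: e2)
  also have "\<dots> = int_theta (\<lambda>n. 1) (\<lambda>n. 9 * theta_exp 1 3 n + 1)"
    by (rule int_theta_reflect[where c = "\<lambda>n. 1"])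
  also have "\<dots> = fps_X * (theta 1 1 3 oo fps_X ^ 9)"
    by (simp only: int_theta_shift) (simp add: int_theta_compose theta_def)
  finally have 2: "int_theta (\<lambda>n. 1) (\<lambda>n. theta_exp 1 3 (3 * n + 1)) = fps_X * (theta 1 1 3 oo fps_X ^ 9)" .
  have "theta 1 1 3 = int_theta (\<lambda>n. 1) (\<lambda>n. theta_exp 1 3 (3 * n))
    + int_theta (\<lambda>n. 1) (\<lambda>n. theta_exp 1 3 (3 * n + 1)) + int_theta (\<lambda>n. 1) (\<lambda>n. theta_exp 1 3 (3 * n - 1))"
    unfolding theta_def by (subst int_theta_split_3[OF finite_theta_exp]) simp_all
  then show ?thesis
    unfolding A 0 1 2 by (simp add: fps_compose_add_distrib add_ac)
qed

section \<open>Theta functions as quotients of f_k = \<open>euler k\<close>\<close>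

definition euler :: "nat \<Rightarrow> rat fps" where
  "euler k = qprod (-1) k k"

lemma euler_nth_0: "k > 0 \<Longrightarrow> euler k $ 0 = 1"
  by (simp add: euler_def qprod_nth_0)

lemma euler_nonzero: "k > 0 \<Longrightarrow> euler k \<noteq> 0"
  using euler_nth_0[of k] by auto

lemma theta_eq_qprod:
  "e * e = 1 \<Longrightarrow> r > 0 \<Longrightarrow> s > 0 \<Longrightarrow> theta e r s = qprod e r (r + s) * qprod e s (r + s) * euler (r + s)"
  by (simp add: theta_def euler_def triple_product)

lemma qprod_one_two: "qprod (-1) 1 2 * euler 2 = euler 1"
  using qprod_dissect_2[of 1 1 "-1"] by (simp add: euler_def del: One_nat_def)

lemma phi_product: "theta (-1) 1 1 * euler 2 = euler 1 ^ 2"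
  by (simp add: theta_eq_qprod power2_eq_square qprod_one_two[symmetric] mult_ac del: One_nat_def)

text \<open>The plus signs disappear through (-q; q^2)(q; q^2) = (q^2; q^4).\<close>

lemma psi_product: "theta 1 1 3 * euler 1 = euler 2 ^ 2"
proof -
  have 1: "qprod 1 1 2 = qprod 1 1 4 * qprod 1 3 4"
    using qprod_dissect_2[of 1 2 1] by (simp del: One_nat_def)
  have 2: "qprod 1 1 2 * qprod (-1) 1 2 = qprod (-1) 2 4"
    using qprod_plus_minus[of 1 2] by (simp del: One_nat_def)
  have 3: "euler 2 = qprod (-1) 2 4 * euler 4"
    using qprod_dissect_2[of 2 2 "-1"] by (simp add: euler_def del: One_nat_def)
  have "theta 1 1 3 = qprod 1 1 2 * euler 4" unfolding 1 by (simp add: theta_eq_qprod del: One_nat_def)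
  then have "theta 1 1 3 * euler 1 = (qprod 1 1 2 * qprod (-1) 1 2) * euler 4 * euler 2"
    by (simp add: qprod_one_two[symmetric] mult_ac del: One_nat_def)
  then show ?thesis unfolding 2 by (simp add: 3[symmetric] power2_eq_square)
qed

text \<open>f(q, q^2) is (-q; q)(q^3; q^3) / (-q^3; q^3), and (-q^k; q^k) = f_2k / f_k.\<close>

lemma theta_1_2_product: "theta 1 1 2 * euler 6 * euler 1 = euler 2 * euler 3 ^ 2"
proof -
  have 1: "qprod 1 1 1 = qprod 1 1 3 * qprod 1 2 3 * qprod 1 3 3"
    using qprod_dissect_3[of 1 1 1] by (simp del: One_nat_def)
  have 2: "qprod 1 1 1 * euler 1 = euler 2" "qprod 1 3 3 * euler 3 = euler 6"
    using qprod_plus_minus[of 1 1] qprod_plus_minus[of 3 3] by (simp_all add: euler_def del: One_nat_def)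
  have "theta 1 1 2 = qprod 1 1 3 * qprod 1 2 3 * euler 3" by (simp add: theta_eq_qprod del: One_nat_def)
  then have "theta 1 1 2 * euler 6 * euler 1 = (qprod 1 1 1 * euler 1) * euler 3 * euler 3"
    unfolding 1 2(2)[symmetric] by (simp add: mult_ac)
  then show ?thesis unfolding 2 by (simp add: power2_eq_square mult_ac)
qed

lemma theta_1_5_product: "theta (-1) 1 5 * euler 3 * euler 2 = euler 1 * euler 6 ^ 2"
proof -
  have 1: "qprod (-1) 1 2 = qprod (-1) 1 6 * qprod (-1) 3 6 * qprod (-1) 5 6"
    using qprod_dissect_3[of 1 2 "-1"] by (simp del: One_nat_def)
  have 2: "euler 3 = qprod (-1) 3 6 * euler 6"
    using qprod_dissect_2[of 3 3 "-1"] by (simp add: euler_def del: One_nat_def)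
  have "theta (-1) 1 5 = qprod (-1) 1 6 * qprod (-1) 5 6 * euler 6" by (simp add: theta_eq_qprod del: One_nat_def)
  then have "theta (-1) 1 5 * euler 3 * euler 2 = (qprod (-1) 1 2 * euler 2) * euler 6 * euler 6"
    unfolding 1 2 by (simp add: mult_ac)
  then show ?thesis unfolding qprod_one_two by (simp add: power2_eq_square mult_ac)
qed

lemma tendsto_compose_X_power:
  fixes a :: "rat fps"
  assumes "(f \<longlongrightarrow> a) F"
  shows "((\<lambda>x. f x oo fps_X ^ k) \<longlongrightarrow> a oo fps_X ^ k) F"
proof (rule tendsto_fpsI)
  fix n
  have "eventually (\<lambda>x. f x $ (n div k) = a $ (n div k)) F"
    using assms by (auto simp: tendsto_fps_iff)
  then show "eventually (\<lambda>x. (f x oo fps_X ^ k) $ n = (a oo fps_X ^ k) $ n) F"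
    by eventually_elim (simp add: fps_nth_compose_X_power)
qed

lemma euler_compose:
  assumes "k > 0" "c > 0"
  shows "euler k oo fps_X ^ c = euler (c * k)"
  unfolding euler_def
proof (rule LIMSEQ_unique)
  show "(\<lambda>N. qprod_fin (-1) k k N oo fps_X ^ c) \<longlonglongrightarrow> (qprod (-1) k k oo fps_X ^ c)"
    by (intro tendsto_compose_X_power qprod_tendsto assms)
  have X: "fps_X ^ m oo fps_X ^ c = (fps_X ^ (c * m) :: rat fps)" for m
    using assms by (simp add: fps_X_power_compose flip: power_mult)
  have "qprod_fin (-1) k k N oo fps_X ^ c = qprod_fin (-1) (c * k) (c * k) N" for N
    using assms by (induction N)
      (simp_all add: fps_compose_mult_distrib fps_compose_add_distrib X ring_distribs mult_ac)
  then show "(\<lambda>N. (qprod_fin (-1) k k N) oo (fps_X ^ c)) \<longlonglongrightarrow> qprod (-1) (c * k) (c * k)"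
    using assms by (simp add: qprod_tendsto)
qed

lemma compose_X3_X3: "(F oo fps_X ^ 3) oo fps_X ^ 3 = (F oo fps_X ^ 9 :: rat fps)"
proof (rule fps_ext)
  fix n
  show "((F oo fps_X ^ 3) oo fps_X ^ 3) $ n = (F oo fps_X ^ 9) $ n"
    using dvd_mult_div_cancel[of 3 n] by (auto simp: fps_nth_compose_X_power div_mult2_eq[symmetric] elim!: dvdE)
qed

text \<open>Multiply the dissections of phi(-q) and psi(q), whose product is f_1 f_2. With A = f(q,
  q^2) and B = f(-q, -q^5) one has A B = f_3 f_6, so the two middle products are f_9 f_18 and -2 f_9
  f_18; their sum explains the coefficient -1 of q. The series p' stands for 1/p.\<close>

lemma euler_12_dissection:
  obtains p p' where "p * p' = 1"
    "euler 1 * euler 2 = euler 9 * euler 18 *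
      ((p oo fps_X ^ 3) - fps_X - 2 * fps_X ^ 2 * (p' oo fps_X ^ 3))"
proof -
  let ?\<phi> = "theta (-1) 1 1" and ?\<psi> = "theta 1 1 3" and ?A = "theta 1 1 2" and ?B = "theta (-1) 1 5"
  note nz = euler_nonzero
  have "(?\<phi> * ?\<psi>) * (euler 1 * euler 2) = (?\<phi> * euler 2) * (?\<psi> * euler 1)" by (simp add: mult_ac)
  also have "\<dots> = (euler 1 * euler 2) * (euler 1 * euler 2)"
    unfolding phi_product psi_product by (simp add: power2_eq_square mult_ac)
  finally have pp: "?\<phi> * ?\<psi> = euler 1 * euler 2" using nz[of 1] nz[of 2] by simp
  have "(?A * ?B) * (euler 1 * euler 2 * euler 3 * euler 6)
      = (?A * euler 6 * euler 1) * (?B * euler 3 * euler 2)" by (simp add: mult_ac)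
  also have "\<dots> = (euler 3 * euler 6) * (euler 1 * euler 2 * euler 3 * euler 6)"
    unfolding theta_1_2_product theta_1_5_product by (simp add: power2_eq_square mult_ac)
  finally have AB: "?A * ?B = euler 3 * euler 6" using nz[of 1] nz[of 2] nz[of 3] nz[of 6] by simp
  define D where "D = inverse (euler 3 * euler 6)"
  have D: "euler 3 * euler 6 * D = 1"
    unfolding D_def by (intro inverse_mult_eq_1') (simp add: euler_nth_0)
  \<comment> \<open>Chosen so that f_9 f_18 p(q^3) is the residue 0 term phi(-q^9) A(q^3); p' does
    the same for the q^2 term.\<close>
  define p where "p = (?\<phi> oo fps_X ^ 3) * ?A * D"
  define p' where "p' = (?\<psi> oo fps_X ^ 3) * ?B * D"
  note hom = fps_compose_mult_distrib
  have c3: "(?\<phi> oo fps_X ^ 3) * (?\<psi> oo fps_X ^ 3) = euler 3 * euler 6"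
    using arg_cong[OF pp, of "\<lambda>F. F oo fps_X ^ 3"] by (simp add: hom euler_compose)
  have "p * p' = ((?\<phi> oo fps_X ^ 3) * (?\<psi> oo fps_X ^ 3)) * (?A * ?B) * D * D"
    by (simp add: p_def p'_def mult_ac)
  also have "\<dots> = (euler 3 * euler 6 * D) * (euler 3 * euler 6 * D)"
    unfolding c3 AB by (simp add: mult_ac)
  finally have 1: "p * p' = 1" unfolding D by simp
  have AB3: "(?A oo fps_X ^ 3) * (?B oo fps_X ^ 3) = euler 9 * euler 18"
    using arg_cong[OF AB, of "\<lambda>F. F oo fps_X ^ 3"] by (simp add: hom euler_compose)
  have c9: "(?\<phi> oo fps_X ^ 9) * (?\<psi> oo fps_X ^ 9) = euler 9 * euler 18"
    using arg_cong[OF pp, of "\<lambda>F. F oo fps_X ^ 9"] by (simp add: hom euler_compose)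
  have D9: "euler 9 * euler 18 * (D oo fps_X ^ 3) = 1"
    using arg_cong[OF D, of "\<lambda>F. F oo fps_X ^ 3"] by (simp add: hom euler_compose)
  have p3: "euler 9 * euler 18 * (p oo fps_X ^ 3) = (?\<phi> oo fps_X ^ 9) * (?A oo fps_X ^ 3)"
  proof -
    have "euler 9 * euler 18 * (p oo fps_X ^ 3)
       = (euler 9 * euler 18 * (D oo fps_X ^ 3)) * ((?\<phi> oo fps_X ^ 9) * (?A oo fps_X ^ 3))"
      by (simp add: p_def hom compose_X3_X3 mult_ac)
    then show ?thesis unfolding D9 by simp
  qed
  have p'3: "euler 9 * euler 18 * (p' oo fps_X ^ 3) = (?\<psi> oo fps_X ^ 9) * (?B oo fps_X ^ 3)"
  proof -
    have "euler 9 * euler 18 * (p' oo fps_X ^ 3)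
       = (euler 9 * euler 18 * (D oo fps_X ^ 3)) * ((?\<psi> oo fps_X ^ 9) * (?B oo fps_X ^ 3))"
      by (simp add: p'_def hom compose_X3_X3 mult_ac)
    then show ?thesis unfolding D9 by simp
  qed
  have "euler 1 * euler 2 = ((?\<phi> oo fps_X ^ 9) - 2 * fps_X * (?B oo fps_X ^ 3)) *
        ((?A oo fps_X ^ 3) + fps_X * (?\<psi> oo fps_X ^ 9))"
    unfolding pp[symmetric] phi_dissection[symmetric] psi_dissection[symmetric] ..
  also have "\<dots> = (?\<phi> oo fps_X ^ 9) * (?A oo fps_X ^ 3)
      + fps_X * ((?\<phi> oo fps_X ^ 9) * (?\<psi> oo fps_X ^ 9) - 2 * ((?A oo fps_X ^ 3) * (?B oo fps_X ^ 3)))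
      - 2 * fps_X ^ 2 * ((?\<psi> oo fps_X ^ 9) * (?B oo fps_X ^ 3))"
    by (simp add: algebra_simps power2_eq_square)
  also have "\<dots> = euler 9 * euler 18 * ((p oo fps_X ^ 3) - fps_X - 2 * fps_X ^ 2 * (p' oo fps_X ^ 3))"
    unfolding AB3 c9 p3[symmetric] p'3[symmetric] by (simp add: algebra_simps)
  finally show ?thesis using 1 that by blast
qed

subsection \<open>Trisection and the cubic norm\<close>

definition trisect :: "nat \<Rightarrow> rat fps \<Rightarrow> rat fps" where
  "trisect r F = Abs_fps (\<lambda>n. F $ (3 * n + r))"

lemma trisect_nth [simp]: "trisect r F $ n = F $ (3 * n + r)"
  by (simp add: trisect_def)

lemma trisect_add [simp]: "trisect r (F + G) = trisect r F + trisect r G"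
  and trisect_0 [simp]: "trisect r 0 = 0"
  and trisect_of_int_mult: "trisect r (of_int c * F) = of_int c * trisect r F"
  by (simp_all add: fps_eq_iff fps_of_int[symmetric])

lemma trisect_decompose:
  "F = (trisect 0 F oo fps_X ^ 3) + fps_X * (trisect 1 F oo fps_X ^ 3) + fps_X ^ 2 * (trisect 2 F oo fps_X ^ 3)"
proof (rule fps_ext)
  fix n :: nat
  consider k where "n = 3 * k" | k where "n = 3 * k + 1" | k where "n = 3 * k + 2"
  proof -
    have "\<exists>k. n = 3 * k \<or> n = 3 * k + 1 \<or> n = 3 * k + 2" by presburger
    then show thesis using that by blast
  qed
  then show "F $ n = ((trisect 0 F oo fps_X ^ 3) + fps_X * (trisect 1 F oo fps_X ^ 3)
      + fps_X ^ 2 * (trisect 2 F oo fps_X ^ 3)) $ n"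
  proof cases
    case 1
    have "\<not> 3 dvd 3 * k - Suc 0" if "k > 0" using that by presburger
    moreover have "\<not> 3 dvd 3 * k - 2" if "k > 0" using that by presburger
    ultimately show ?thesis
      by (cases "k = 0") (simp_all add: 1 fps_nth_compose_X_power fps_X_power_mult_nth)
  next
    case 2
    have "\<not> 3 dvd Suc (3 * k)" by presburger
    moreover have "\<not> 3 dvd Suc (3 * k) - 2" if "k > 0" using that by presburger
    ultimately show ?thesis
      by (cases "k = 0") (simp_all add: 2 fps_nth_compose_X_power fps_X_power_mult_nth)
  next
    case 3
    have "\<not> 3 dvd Suc (Suc (3 * k))" "\<not> 3 dvd Suc (3 * k)" by presburger+
    then show ?thesis
      by (simp add: 3 fps_nth_compose_X_power fps_X_power_mult_nth)
  qed
qed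

lemma trisect_compose_mult [simp]:
  assumes "r < 3"
  shows "trisect r ((F oo fps_X ^ 3) * G) = F * trisect r G"
proof (rule fps_ext)
  fix n
  have "(\<Sum>i=0..3 * n + r. (F oo fps_X ^ 3) $ i * G $ (3 * n + r - i))
      = (\<Sum>i\<in>(\<lambda>i. 3 * i) ` {0..n}. (F oo fps_X ^ 3) $ i * G $ (3 * n + r - i))"
    by (rule sum.mono_neutral_right) (use assms in \<open>auto simp: fps_nth_compose_X_power elim!: dvdE\<close>)
  also have "\<dots> = (\<Sum>i=0..n. F $ i * G $ (3 * (n - i) + r))"
    by (subst sum.reindex) (auto simp: inj_on_def fps_nth_compose_X_power diff_mult_distrib2 intro!: sum.cong)
  finally show "trisect r ((F oo fps_X ^ 3) * G) $ n = (F * trisect r G) $ n"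
    by (simp add: fps_mult_nth)
qed

lemma trisect_X_power_mult:
  "trisect 0 (fps_X * F) = fps_X * trisect 2 F"
  "trisect 1 (fps_X * F) = trisect 0 F"
  "trisect 2 (fps_X * F) = trisect 1 F"
proof -
  show "trisect 0 (fps_X * F) = fps_X * trisect 2 F"
  proof (rule fps_ext)
    fix n show "trisect 0 (fps_X * F) $ n = (fps_X * trisect 2 F) $ n"
      by (cases n) simp_all
  qed
qed (simp_all add: fps_eq_iff)

lemma trisect_one: "trisect 0 1 = 1" "trisect 1 1 = 0" "trisect 2 1 = 0"
  by (simp_all add: fps_eq_iff)

lemma trisect_eqI:
  fixes a b c :: "rat fps"
  assumes "F = (a oo fps_X ^ 3) + fps_X * (b oo fps_X ^ 3) + fps_X ^ 2 * (c oo fps_X ^ 3)"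
  shows "trisect 0 F = a" "trisect 1 F = b" "trisect 2 F = c"
proof -
  have "F = (a oo fps_X ^ 3) * 1 + (b oo fps_X ^ 3) * (fps_X * 1) + (c oo fps_X ^ 3) * (fps_X * (fps_X * 1))"
    unfolding assms by (simp add: power2_eq_square mult_ac)
  then show "trisect 0 F = a" "trisect 1 F = b" "trisect 2 F = c"
    by (simp_all only: trisect_add trisect_compose_mult trisect_X_power_mult trisect_one) simp_all
qed

lemma X_compose_X3: "(fps_X :: rat fps) oo fps_X ^ 3 = fps_X ^ 3"
  using fps_X_power_compose[of "fps_X ^ 3 :: rat fps" 1] by simp

lemma trisect_mult:
  "trisect 0 (F * G) = trisect 0 F * trisect 0 G + fps_X * (trisect 1 F * trisect 2 G + trisect 2 F * trisect 1 G)"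
  "trisect 1 (F * G) = trisect 0 F * trisect 1 G + trisect 1 F * trisect 0 G + fps_X * trisect 2 F * trisect 2 G"
  "trisect 2 (F * G) = trisect 0 F * trisect 2 G + trisect 1 F * trisect 1 G + trisect 2 F * trisect 0 G"
proof -
  have "F * G = ((trisect 0 F oo fps_X ^ 3) + fps_X * (trisect 1 F oo fps_X ^ 3) + fps_X ^ 2 * (trisect 2 F oo fps_X ^ 3)) *
     ((trisect 0 G oo fps_X ^ 3) + fps_X * (trisect 1 G oo fps_X ^ 3) + fps_X ^ 2 * (trisect 2 G oo fps_X ^ 3))"
    by (rule arg_cong2[of _ _ _ _ times, OF trisect_decompose trisect_decompose])
  also have "\<dots> =
    (trisect 0 F * trisect 0 G + fps_X * (trisect 1 F * trisect 2 G + trisect 2 F * trisect 1 G) oo fps_X ^ 3)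
    + fps_X * (trisect 0 F * trisect 1 G + trisect 1 F * trisect 0 G + fps_X * trisect 2 F * trisect 2 G oo fps_X ^ 3)
    + fps_X ^ 2 * (trisect 0 F * trisect 2 G + trisect 1 F * trisect 1 G + trisect 2 F * trisect 0 G oo fps_X ^ 3)"
    by (simp add: fps_compose_mult_distrib fps_compose_add_distrib X_compose_X3)
       (simp add: algebra_simps power2_eq_square power3_eq_cube)
  finally show "trisect 0 (F * G) = trisect 0 F * trisect 0 G + fps_X * (trisect 1 F * trisect 2 G + trisect 2 F * trisect 1 G)"
    "trisect 1 (F * G) = trisect 0 F * trisect 1 G + trisect 1 F * trisect 0 G + fps_X * trisect 2 F * trisect 2 G"
    "trisect 2 (F * G) = trisect 0 F * trisect 2 G + trisect 1 F * trisect 1 G + trisect 2 F * trisect 0 G"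
    by (rule trisect_eqI)+
qed

text \<open>The product of \<open>a + y b + y\<^sup>2 c\<close> over the three cube roots \<open>y\<close> of \<open>x\<close>, written as a
  circulant determinant so that no roots of unity are needed.\<close>

definition circ_norm :: "'a::comm_ring_1 \<Rightarrow> 'a \<Rightarrow> 'a \<Rightarrow> 'a \<Rightarrow> 'a" where
  "circ_norm x a b c = a ^ 3 + x * b ^ 3 + x ^ 2 * c ^ 3 - 3 * x * a * b * c"

lemma circ_norm_mult:
  "circ_norm x a b c * circ_norm x a' b' c' =
   circ_norm x (a * a' + x * (b * c' + c * b')) (a * b' + b * a' + x * c * c') (a * c' + b * b' + c * a')"
  unfolding circ_norm_def by (simp add: power2_eq_square power3_eq_cube algebra_simps)

text \<open>The series N with N(q^3) = F(q) F(w q) F(w^2 q) for a primitive cube root of unity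
  w.\<close>

definition fps_norm3 :: "rat fps \<Rightarrow> rat fps" where
  "fps_norm3 F = circ_norm fps_X (trisect 0 F) (trisect 1 F) (trisect 2 F)"

lemma fps_norm3_mult: "fps_norm3 (F * G) = fps_norm3 F * fps_norm3 G"
  unfolding fps_norm3_def trisect_mult circ_norm_mult ..

lemma fps_norm3_compose: "fps_norm3 (F oo fps_X ^ 3) = F ^ 3"
proof -
  have "(F oo fps_X ^ 3) = (F oo fps_X ^ 3) + fps_X * (0 oo fps_X ^ 3) + fps_X ^ 2 * (0 oo fps_X ^ 3)"
    by simp
  from trisect_eqI[OF this] show ?thesis by (simp add: fps_norm3_def circ_norm_def)
qed

lemma X_power_compose_X3: "(fps_X :: rat fps) ^ k oo fps_X ^ 3 = fps_X ^ (3 * k)"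
  by (simp add: fps_X_power_compose flip: power_mult)

lemma fps_norm3_one_minus_X_power:
  "fps_norm3 (1 - fps_X ^ m) = (if 3 dvd m then (1 - fps_X ^ (m div 3)) ^ 3 else 1 - fps_X ^ m)"
proof -
  consider k where "m = 3 * k" | k where "m = 3 * k + 1" | k where "m = 3 * k + 2"
  proof -
    have "\<exists>k. m = 3 * k \<or> m = 3 * k + 1 \<or> m = 3 * k + 2" by presburger
    then show ?thesis using that by blast
  qed
  then show ?thesis
  proof cases
    case 1
    have "1 - fps_X ^ m = (1 - fps_X ^ k oo fps_X ^ 3 :: rat fps)"
      by (simp add: 1 fps_compose_sub_distrib X_power_compose_X3)
    then show ?thesis by (simp add: fps_norm3_compose 1)
  next
    case 2
    have "1 - fps_X ^ m = (1 oo fps_X ^ 3) + fps_X * (- (fps_X ^ k) oo fps_X ^ 3) + fps_X ^ 2 * (0 oo fps_X ^ 3 :: rat fps)"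
      by (simp add: 2 fps_compose_uminus X_power_compose_X3)
    note trisect_eqI[OF this]
    moreover have "\<not> 3 dvd m" unfolding 2 by presburger
    ultimately show ?thesis
      by (simp add: fps_norm3_def circ_norm_def 2 power_mult[symmetric] mult.commute)
  next
    case 3
    have "1 - fps_X ^ m = (1 oo fps_X ^ 3) + fps_X * (0 oo fps_X ^ 3) + fps_X ^ 2 * (- (fps_X ^ k) oo fps_X ^ 3 :: rat fps)"
      by (simp add: 3 fps_compose_uminus X_power_compose_X3 power2_eq_square)
    note trisect_eqI[OF this]
    moreover have "\<not> 3 dvd m" unfolding 3 by presburger
    ultimately show ?thesis
      by (simp add: fps_norm3_def circ_norm_def 3 power_mult[symmetric] mult.commute power2_eq_square)
  qed
qed

lemma tendsto_trisect:
  assumes "(f \<longlongrightarrow> a) F"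
  shows "((\<lambda>x. trisect r (f x)) \<longlongrightarrow> trisect r a) F"
  using assms unfolding tendsto_fps_iff by simp

lemma tendsto_fps_norm3:
  assumes "(f \<longlongrightarrow> a) F"
  shows "((\<lambda>x. fps_norm3 (f x)) \<longlongrightarrow> fps_norm3 a) F"
  unfolding fps_norm3_def circ_norm_def
  by (intro tendsto_minus_fps tendsto_add_fps tendsto_mult_fps tendsto_power_fps tendsto_trisect
      tendsto_const assms)

text \<open>A factor 1 - q^(km) with m prime to 3 is its own norm, and the others have norm (1 -
  q^(km/3))^3; hence the norm is (f_k / f_3k) f_k^3. The finite version is exact because among 3N
  factors exactly N have m divisible by 3.\<close>

lemma fps_norm3_euler:
  assumes "\<not> 3 dvd k"
  shows "fps_norm3 (euler k) * euler (3 * k) = euler k ^ 4"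
proof (rule LIMSEQ_unique)
  have k: "k > 0" using assms by (cases k) auto
  let ?q = "\<lambda>k. qprod_fin (-1) k k"
  note lim = qprod_tendsto[OF k k, of "-1", folded euler_def]
  have lim3: "(\<lambda>N. ?q k (3 * N)) \<longlonglongrightarrow> euler k"
    by (rule filterlim_compose[OF lim filterlim_mult_sequentially]) simp
  have q: "?q k (Suc N) = ?q k N * (1 - fps_X ^ (k * Suc N))" for k N
    by (simp flip: fps_const_neg)
  have "fps_norm3 (?q k (3 * N)) * ?q (3 * k) N = ?q k (3 * N) * ?q k N ^ 3" for N
  proof (induction N)
    case 0
    have "fps_norm3 1 = 1" using fps_norm3_compose[of 1] by simp
    then show ?case by simp
  next
    case (Suc N)
    define u where "u = (1 - fps_X ^ (k * (3 * N + 1)) :: rat fps)"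
    define v where "v = (1 - fps_X ^ (k * (3 * N + 2)) :: rat fps)"
    define w where "w = (1 - fps_X ^ (k * (3 * N + 3)) :: rat fps)"
    define z where "z = (1 - fps_X ^ (k * (N + 1)) :: rat fps)"
    have p3: "prime (3::nat)" by simp
    have "\<not> 3 dvd 3 * N + 1" "\<not> 3 dvd 3 * N + 2" by presburger+
    then have "\<not> 3 dvd k * (3 * N + 1)" "\<not> 3 dvd k * (3 * N + 2)"
      using assms by (simp_all only: prime_dvd_mult_iff[OF p3]) auto
    then have n: "fps_norm3 u = u" "fps_norm3 v = v"
      by (simp_all only: u_def v_def fps_norm3_one_minus_X_power if_False)
    have "k * (3 * N + 3) = 3 * (k * (N + 1))" by (simp add: algebra_simps)
    then have n3: "fps_norm3 w = z ^ 3"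
      unfolding w_def z_def fps_norm3_one_minus_X_power by simp
    have e: "?q k (3 * Suc N) = ?q k (3 * N) * u * v * w"
    proof -
      have "3 * Suc N = Suc (Suc (Suc (3 * N)))" by simp
      then show ?thesis unfolding u_def v_def w_def by (simp only: q) (simp add: numeral_3_eq_3)
    qed
    have e1: "?q k (Suc N) = ?q k N * z" unfolding q z_def by simp
    have e2: "?q (3 * k) (Suc N) = ?q (3 * k) N * w"
    proof -
      have "3 * k * Suc N = k * (3 * N + 3)" by (simp add: algebra_simps)
      then show ?thesis unfolding q w_def by (simp only:)
    qed
    have "fps_norm3 (?q k (3 * Suc N)) * ?q (3 * k) (Suc N)
        = (fps_norm3 (?q k (3 * N)) * ?q (3 * k) N) * (u * v * w) * z ^ 3"
      unfolding e e2 fps_norm3_mult n n3 by (simp only: mult_ac)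
    also have "\<dots> = ?q k (3 * Suc N) * ?q k (Suc N) ^ 3"
      unfolding Suc.IH e e1 power_mult_distrib by (simp only: mult_ac)
    finally show ?case .
  qed
  moreover have "(\<lambda>N. fps_norm3 (?q k (3 * N)) * ?q (3 * k) N) \<longlonglongrightarrow> fps_norm3 (euler k) * euler (3 * k)"
    unfolding euler_def[of "3 * k"] using k
    by (intro tendsto_mult_fps tendsto_fps_norm3 lim3 qprod_tendsto) simp_all
  ultimately show "(\<lambda>N. ?q k (3 * N) * ?q k N ^ 3) \<longlonglongrightarrow> fps_norm3 (euler k) * euler (3 * k)"
    by simp
  have "(\<lambda>N. ?q k (3 * N) * ?q k N ^ 3) \<longlonglongrightarrow> euler k * euler k ^ 3"
    by (intro tendsto_mult_fps tendsto_power_fps lim3 lim)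
  then show "(\<lambda>N. ?q k (3 * N) * ?q k N ^ 3) \<longlonglongrightarrow> euler k ^ 4"
    by (simp add: power_numeral_reduce)
qed

text \<open>Take norms on both sides of the dissection. The factor f_9 f_18 is a series in q^3, so
  its norm is a plain cube. The 7 arises as 1 + 6: the cube of the middle coefficient -1 gives -q,
  and the mixed term gives -6 q p p' = -6 q.\<close>

lemma euler_12_norm:
  assumes "p * p' = 1"
    and H: "euler 1 * euler 2 = euler 9 * euler 18 *
      ((p oo fps_X ^ 3) - fps_X - 2 * fps_X ^ 2 * (p' oo fps_X ^ 3))" (is "_ = _ * ?H")
  shows "(euler 1 * euler 2) ^ 4 = (euler 3 * euler 6) ^ 4 * (p ^ 3 - 7 * fps_X - 8 * fps_X ^ 2 * p' ^ 3)"
proof -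
  have "?H = (p oo fps_X ^ 3) + fps_X * (-1 oo fps_X ^ 3) + fps_X ^ 2 * (- (2 * p') oo fps_X ^ 3)"
    by (simp add: fps_compose_uminus fps_compose_mult_distrib numeral_fps_const mult_ac)
  note tri = trisect_eqI[OF this]
  have "fps_norm3 ?H = p ^ 3 - fps_X - 8 * fps_X ^ 2 * p' ^ 3 - 6 * fps_X * (p * p')"
    unfolding fps_norm3_def circ_norm_def tri by (simp add: algebra_simps)
  also have "\<dots> = p ^ 3 - 7 * fps_X - 8 * fps_X ^ 2 * p' ^ 3"
    unfolding assms(1) by (simp add: algebra_simps)
  finally have nH: "fps_norm3 ?H = p ^ 3 - 7 * fps_X - 8 * fps_X ^ 2 * p' ^ 3" .
  have "fps_norm3 (euler 9 * euler 18) = (euler 3 * euler 6) ^ 3"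
    using fps_norm3_compose[of "euler 3 * euler 6"] by (simp add: fps_compose_mult_distrib euler_compose)
  then have n: "fps_norm3 (euler 1 * euler 2) = (euler 3 * euler 6) ^ 3 * fps_norm3 ?H"
    unfolding H fps_norm3_mult[of _ ?H] by simp
  have "(euler 1 * euler 2) ^ 4 = (fps_norm3 (euler 1) * euler 3) * (fps_norm3 (euler 2) * euler 6)"
    using fps_norm3_euler[of 1] fps_norm3_euler[of 2] by (simp add: power_mult_distrib)
  also have "\<dots> = fps_norm3 (euler 1 * euler 2) * (euler 3 * euler 6)"
    by (simp add: fps_norm3_mult mult_ac)
  also have "\<dots> = (euler 3 * euler 6) ^ 4 * fps_norm3 ?H"
    unfolding n by (simp add: power_numeral_reduce mult_ac)
  finally show ?thesis unfolding nH .
qed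

subsection \<open>The recurrence and the congruences\<close>

definition cubic_gf :: "rat fps" where
  "cubic_gf = euler 3 * euler 6 * inverse (euler 1 * euler 2)"

lemma cubic_gf_mult: "cubic_gf * (euler 1 * euler 2) = euler 3 * euler 6"
  unfolding cubic_gf_def mult.assoc
  by (subst inverse_mult_eq_1) (simp_all add: euler_nth_0 del: One_nat_def)

lemma f_trunc_eq_qprod_fin: "f_trunc k N = qprod_fin (-1) k k N"
  unfolding f_trunc_def qprod_fin_def
  by (rule prod.reindex_bij_witness[of _ Suc "\<lambda>i. i - 1"])
    (auto simp: fps_const_neg[symmetric] diff_mult_distrib2 simp del: fps_const_neg)

text \<open>Modulo q^(n+1) every truncation agrees with f_k, and since f_1 f_2 is a unit the
  agreement passes to the quotient.\<close>

lemma a3_eq: "a3 n = cubic_gf $ n"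
proof -
  define t where "t k = f_trunc k n" for k
  have t: "fps_X ^ Suc n dvd t k - euler k" if "k > 0" for k
    unfolding t_def f_trunc_eq_qprod_fin euler_def using that by (intro qprod_fin_cong) auto
  have t0: "t k $ 0 = 1" if "k > 0" for k
    using t[OF that] euler_nth_0[OF that] by (simp add: fps_X_power_dvd_iff del: power_Suc)
  define u where "u = t 3 * t 6 * inverse (t 1 * t 2)"
  have u: "u * (t 1 * t 2) = t 3 * t 6"
    unfolding u_def mult.assoc by (subst inverse_mult_eq_1) (simp_all add: t0 del: One_nat_def)
  have a3: "a3 n = u $ n"
    unfolding a3_def u_def t_def[symmetric] by (subst fps_divide_unit) (simp_all add: t0 del: One_nat_def)
  have c: "fps_X ^ Suc n dvd t i * t j - euler i * euler j" if "i > 0" "j > 0" for i j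
    using that by (intro cong_mult_dvd t)
  have d1: "fps_X ^ Suc n dvd u * (t 1 * t 2 - euler 1 * euler 2)"
    by (intro dvd_mult c) simp_all
  have d2: "fps_X ^ Suc n dvd t 3 * t 6 - euler 3 * euler 6" by (intro c) simp_all
  have "(t 3 * t 6 - euler 3 * euler 6) - u * (t 1 * t 2 - euler 1 * euler 2)
      = (u - cubic_gf) * (euler 1 * euler 2)"
    unfolding u[symmetric] cubic_gf_mult[symmetric] by (simp add: algebra_simps)
  with dvd_diff[OF d2 d1] have "fps_X ^ Suc n dvd (u - cubic_gf) * (euler 1 * euler 2)" by simp
  then have "fps_X ^ Suc n dvd (u - cubic_gf) * (euler 1 * euler 2) * inverse (euler 1 * euler 2)"
    by (rule dvd_mult2)
  moreover have "(euler 1 * euler 2) * inverse (euler 1 * euler 2) = 1"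
    by (rule inverse_mult_eq_1') (simp add: euler_nth_0 del: One_nat_def)
  ultimately have "fps_X ^ Suc n dvd u - cubic_gf" by (simp only: mult.assoc mult_1_right)
  then show ?thesis unfolding a3 by (simp add: fps_X_power_dvd_iff del: power_Suc)
qed

section \<open>Integrality of coefficients and the ring Z[\<tau>]\<close>

definition int_fps :: "rat fps \<Rightarrow> bool" where
  "int_fps F \<longleftrightarrow> (\<forall>n. F $ n \<in> \<int>)"

lemma int_fps_intros:
  shows int_fps_0: "int_fps 0"
    and int_fps_1: "int_fps 1"
    and int_fps_X: "int_fps fps_X"
    and int_fps_of_int: "int_fps (of_int c)"
    and int_fps_numeral: "int_fps (numeral m)"
    and int_fps_add: "int_fps F \<Longrightarrow> int_fps G \<Longrightarrow> int_fps (F + G)"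
    and int_fps_diff: "int_fps F \<Longrightarrow> int_fps G \<Longrightarrow> int_fps (F - G)"
    and int_fps_mult: "int_fps F \<Longrightarrow> int_fps G \<Longrightarrow> int_fps (F * G)"
  by (auto simp: int_fps_def fps_mult_nth fps_of_int[symmetric] numeral_fps_const fps_X_def
      intro!: Ints_sum Ints_mult)

lemma int_fps_power: "int_fps F \<Longrightarrow> int_fps (F ^ k)"
  by (induction k) (auto intro: int_fps_intros)

lemma int_fps_compose: "int_fps F \<Longrightarrow> int_fps (F oo fps_X ^ k)"
  by (simp add: int_fps_def fps_nth_compose_X_power)

text \<open>With constant term 1 the recursion for the coefficients of the inverse involves no
  division.\<close>

lemma int_fps_inverse:
  assumes "int_fps F" "F $ 0 = 1"
  shows "int_fps (inverse F)"
  unfolding int_fps_def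
proof
  fix n
  show "inverse F $ n \<in> \<int>"
  proof (induction n rule: less_induct)
    case (less n)
    show ?case
    proof (cases "n = 0")
      case True
      then show ?thesis using assms by simp
    next
      case False
      then have "inverse F $ n = - (\<Sum>i=1..n. F $ i * inverse F $ (n - i))"
        using assms(2) by (cases n) (simp_all add: fps_inverse_def)
      moreover have "F $ i * inverse F $ (n - i) \<in> \<int>" if "i \<in> {1..n}" for i
        using that assms(1) less[of "n - i"] by (auto simp: int_fps_def)
      ultimately show ?thesis by (auto intro!: Ints_sum Ints_minus)
    qed
  qed
qed

lemma int_fps_euler: "int_fps (euler k)"
proof -
  have "int_fps (qprod_fin (-1) k k N)" for N
    by (induction N) (auto simp flip: fps_const_neg intro!: int_fps_intros int_fps_power)
  then show ?thesis by (simp add: euler_def qprod_def int_fps_def del: qprod_fin_Suc)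
qed

lemma int_fps_cubic_gf: "int_fps cubic_gf"
  unfolding cubic_gf_def
  by (intro int_fps_mult int_fps_inverse int_fps_euler) (simp add: euler_nth_0 del: One_nat_def)

text \<open>The ring Z[t], generated one integer monomial at a time, so that rule induction reduces
  a claim linear in x to the powers of t.\<close>

inductive_set int_polys :: "rat fps \<Rightarrow> rat fps set" for t where
  zero: "0 \<in> int_polys t"
| add_term: "x \<in> int_polys t \<Longrightarrow> x + of_int c * t ^ i \<in> int_polys t"

lemma int_polys_add:
  assumes "y \<in> int_polys t" "x \<in> int_polys t"
  shows "x + y \<in> int_polys t"
  using assms(1)
proof induction
  case (add_term y c i)
  then show ?case using int_polys.add_term[of "x + y" t c i] by (simp add: add.assoc)
qed (use assms(2) in simp)

lemma int_polys_times:
  assumes "x \<in> int_polys t"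
  shows "t * x \<in> int_polys t"
  using assms
proof induction
  case (add_term x c i)
  then show ?case using int_polys.add_term[of "t * x" t c "Suc i"] by (simp add: algebra_simps)
qed (simp add: int_polys.zero)

lemma int_polys_of_int_mult:
  assumes "x \<in> int_polys t"
  shows "of_int m * x \<in> int_polys t"
  using assms
proof induction
  case (add_term x c i)
  then show ?case using int_polys.add_term[of "of_int m * x" t "m * c" i] by (simp add: algebra_simps)
qed (simp add: int_polys.zero)

lemma int_polys_1: "1 \<in> int_polys t"
  using int_polys.add_term[of 0 t 1 0, OF int_polys.zero] by simp

abbreviation S3 :: "rat fps \<Rightarrow> rat fps" where "S3 F \<equiv> F oo fps_X ^ 3"

text \<open>Up to the factor 9, \<open>\<tau>\<close> is the Hauptmodul \<open>q (f\<^sub>3 f\<^sub>6 / (f\<^sub>1 f\<^sub>2))\<^sup>4\<close>. The scaling by 9 turns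
  the needed powers of 3 into integrality of polynomials in \<open>\<tau>\<close>.\<close>

definition \<tau> :: "rat fps" where "\<tau> = 9 * fps_X * cubic_gf ^ 4"

text \<open>The product g(q) g(q^3) telescopes to f_9 f_18 / (f_1 f_2), the reciprocal of the
  bracket in the dissection. The factor 3q makes the three coefficients of its cubic equation
  equal.\<close>

definition Z3 :: "rat fps" where "Z3 = 3 * fps_X * (cubic_gf * S3 cubic_gf)"

lemma S3_tau: "S3 \<tau> = 9 * fps_X ^ 3 * S3 cubic_gf ^ 4"
  by (simp add: \<tau>_def fps_compose_mult_distrib X_compose_X3 numeral_fps_const fps_compose_power)

text \<open>The first two relations sort Z and Z^2 by exponents modulo 3, which supplies the initial
  values of the recurrence; the third is the recurrence before trisection.\<close>

lemma Z3_relations: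
  obtains p p' where "p * p' = 1"
    "Z3 = 3 * S3 cubic_gf ^ 4 * (3 * fps_X ^ 3 + fps_X * (S3 p ^ 2 - 2 * fps_X ^ 3 * S3 p')
             + fps_X ^ 2 * (S3 p + 4 * fps_X ^ 3 * S3 p' ^ 2))"
    "Z3 ^ 2 = S3 cubic_gf ^ 4 * (9 * fps_X ^ 2 * (S3 p - fps_X - 2 * fps_X ^ 2 * S3 p') + 27 * fps_X ^ 3 + 27 * fps_X ^ 3 * Z3)"
    "Z3 ^ 3 = 3 * S3 \<tau> * (1 + Z3 + Z3 ^ 2)"
proof -
  let ?g = cubic_gf
  let ?G = "S3 ?g"
  obtain p p' where pp: "p * p' = 1" and H: "euler 1 * euler 2 = euler 9 * euler 18 *
      (S3 p - fps_X - 2 * fps_X ^ 2 * S3 p')"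
    by (rule euler_12_dissection)
  define h where "h = S3 p - fps_X - 2 * fps_X ^ 2 * S3 p'"
  define Y where "Y = ?g * ?G"
  note nz = euler_nonzero
  have pp3: "S3 p * S3 p' = 1"
    using arg_cong[OF pp, of S3] by (simp add: fps_compose_mult_distrib)
  have G: "?G * (euler 3 * euler 6) = euler 9 * euler 18"
    using arg_cong[OF cubic_gf_mult, of S3] by (simp add: fps_compose_mult_distrib euler_compose del: One_nat_def)
  have "(Y * h) * (euler 3 * euler 6) = ?g * (euler 9 * euler 18 * h)"
    unfolding G[symmetric] Y_def by (simp add: mult_ac)
  also have "\<dots> = 1 * (euler 3 * euler 6)"
    unfolding h_def H[symmetric] cubic_gf_mult by simp
  finally have Yh: "Y * h = 1" using nz[of 3] nz[of 6] by (simp del: One_nat_def)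
  have "(?g ^ 4 * (p ^ 3 - 7 * fps_X - 8 * fps_X ^ 2 * p' ^ 3)) * (euler 1 * euler 2) ^ 4
      = (?g * (euler 1 * euler 2)) ^ 4 * (p ^ 3 - 7 * fps_X - 8 * fps_X ^ 2 * p' ^ 3)"
    by (simp add: power_mult_distrib mult_ac)
  also have "\<dots> = 1 * (euler 1 * euler 2) ^ 4"
    unfolding cubic_gf_mult euler_12_norm[OF pp H] by simp
  finally have g4: "?g ^ 4 * (p ^ 3 - 7 * fps_X - 8 * fps_X ^ 2 * p' ^ 3) = 1"
    using nz[of 1] nz[of 2] by (simp del: One_nat_def)
  have "?G ^ 4 * (S3 p ^ 3 - 7 * fps_X ^ 3 - 8 * fps_X ^ 6 * S3 p' ^ 3) = 1"
    using arg_cong[OF g4, of S3]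
    by (simp add: fps_compose_mult_distrib fps_compose_sub_distrib fps_compose_power[symmetric] X_compose_X3
        numeral_fps_const flip: power_mult)
  \<comment> \<open>With P = \<open>S3 p\<close>, h + q = P - 2 q^2 / P. Cubing a - b with a b = 2
    q^2 gives (h + q)^3 + 6 q^2 (h + q) = P^3 - 8 q^6 / P^3, and the left side is the present one
    plus 7 q^3.\<close>
  moreover have "h ^ 3 + 3 * fps_X * h ^ 2 + 9 * fps_X ^ 2 * h = S3 p ^ 3 - 7 * fps_X ^ 3 - 8 * fps_X ^ 6 * S3 p' ^ 3"
    using pp3 unfolding h_def by algebra
  ultimately have G4: "?G ^ 4 * (h ^ 3 + 3 * fps_X * h ^ 2 + 9 * fps_X ^ 2 * h) = 1" by simp
  \<comment> \<open>Since Y = 1/h, multiplying \<open>G4\<close> by Y one, two and three times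
    trades powers of h for powers of Y.\<close>
  have Y1: "Y = ?G ^ 4 * (h ^ 2 + 3 * fps_X * h + 9 * fps_X ^ 2)"
    using G4 Yh by algebra
  have Y2: "Y ^ 2 = ?G ^ 4 * (h + 3 * fps_X + 9 * fps_X ^ 2 * Y)"
    using Y1 Yh by algebra
  have Y3: "Y ^ 3 = ?G ^ 4 * (1 + 3 * fps_X * Y + 9 * fps_X ^ 2 * Y ^ 2)"
    using Y2 Yh by algebra
  have Z: "Z3 = 3 * fps_X * Y" by (simp add: Z3_def Y_def)
  have "Z3 = 3 * ?G ^ 4 * (fps_X * (h ^ 2 + 3 * fps_X * h + 9 * fps_X ^ 2))"
    unfolding Z by (subst Y1) (simp only: mult_ac)
  also have "fps_X * (h ^ 2 + 3 * fps_X * h + 9 * fps_X ^ 2) = 3 * fps_X ^ 3 + fps_X * (S3 p ^ 2 - 2 * fps_X ^ 3 * S3 p')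
             + fps_X ^ 2 * (S3 p + 4 * fps_X ^ 3 * S3 p' ^ 2)"
    using pp3 unfolding h_def by algebra
  finally have 1: "Z3 = 3 * ?G ^ 4 * (3 * fps_X ^ 3 + fps_X * (S3 p ^ 2 - 2 * fps_X ^ 3 * S3 p')
             + fps_X ^ 2 * (S3 p + 4 * fps_X ^ 3 * S3 p' ^ 2))" .
  have "Z3 ^ 2 = ?G ^ 4 * (9 * fps_X ^ 2 * h + 27 * fps_X ^ 3 + 27 * fps_X ^ 3 * Z3)"
    unfolding Z power_mult_distrib Y2 by (simp add: algebra_simps power2_eq_square power3_eq_cube)
  then have 2: "Z3 ^ 2 = ?G ^ 4 * (9 * fps_X ^ 2 * (S3 p - fps_X - 2 * fps_X ^ 2 * S3 p') + 27 * fps_X ^ 3 + 27 * fps_X ^ 3 * Z3)"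
    unfolding h_def .
  have 3: "Z3 ^ 3 = 3 * S3 \<tau> * (1 + Z3 + Z3 ^ 2)"
    unfolding Z power_mult_distrib Y3 S3_tau by (simp add: algebra_simps power2_eq_square power3_eq_cube)
  show ?thesis using that[OF pp 1 2 3] .
qed

text \<open>A factor that is a series in q^3 leaves the trisection with q^3 replaced by q, so
  \<open>S3 \<tau>\<close> becomes \<tau>. The cubic equation for Z is thereby a linear recurrence
  of order 3.\<close>

lemma trisect_Z3_recurrence:
  "trisect 0 (Z3 ^ 0) = 1"
  "trisect 0 (Z3 ^ 1) = \<tau>"
  "trisect 0 (Z3 ^ 2) = 2 * \<tau> + 3 * \<tau> ^ 2"
  "trisect 0 (Z3 ^ (k + 3)) = 3 * \<tau> * (trisect 0 (Z3 ^ k) + trisect 0 (Z3 ^ (k + 1)) + trisect 0 (Z3 ^ (k + 2)))"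
proof -
  obtain p p' where pp: "p * p' = 1"
    and 1: "Z3 = 3 * S3 cubic_gf ^ 4 * (3 * fps_X ^ 3 + fps_X * (S3 p ^ 2 - 2 * fps_X ^ 3 * S3 p')
             + fps_X ^ 2 * (S3 p + 4 * fps_X ^ 3 * S3 p' ^ 2))"
    and 2: "Z3 ^ 2 = S3 cubic_gf ^ 4 * (9 * fps_X ^ 2 * (S3 p - fps_X - 2 * fps_X ^ 2 * S3 p') + 27 * fps_X ^ 3 + 27 * fps_X ^ 3 * Z3)"
    and 3: "Z3 ^ 3 = 3 * S3 \<tau> * (1 + Z3 + Z3 ^ 2)"
    by (rule Z3_relations)
  note hom = fps_compose_mult_distrib fps_compose_sub_distrib fps_compose_add_distrib
    fps_compose_power[symmetric] X_compose_X3 numeral_fps_const fps_compose_uminus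
  show "trisect 0 (Z3 ^ 0) = 1" by (simp add: trisect_one)
  have "Z3 = S3 \<tau> + fps_X * S3 (3 * cubic_gf ^ 4 * (p ^ 2 - 2 * fps_X * p'))
      + fps_X ^ 2 * S3 (3 * cubic_gf ^ 4 * (p + 4 * fps_X * p' ^ 2))"
    unfolding S3_tau by (subst 1) (simp add: hom, simp add: algebra_simps flip: numeral_fps_const)
  from trisect_eqI(1)[OF this] show Z1: "trisect 0 (Z3 ^ 1) = \<tau>" by simp
  \<comment> \<open>In residue 0 only -9 q^3 and 27 q^3 survive; their sum 18 q^3 yields the term 2
    \<tau>.\<close>
  define M where "M = 9 * fps_X ^ 2 * (S3 p - fps_X - 2 * fps_X ^ 2 * S3 p') + 27 * fps_X ^ 3"
  have "M = S3 (18 * fps_X) + fps_X * S3 (- (18 * fps_X * p')) + fps_X ^ 2 * S3 (9 * p)"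
    unfolding M_def
    by (simp add: hom, simp add: algebra_simps power2_eq_square power3_eq_cube flip: numeral_fps_const)
  note M = trisect_eqI(1)[OF this]
  have "Z3 ^ 2 = S3 (cubic_gf ^ 4) * (M + S3 (27 * fps_X) * Z3)"
    unfolding 2 M_def by (simp add: hom flip: numeral_fps_const)
  then have "trisect 0 (Z3 ^ 2) = cubic_gf ^ 4 * (18 * fps_X + 27 * fps_X * trisect 0 Z3)"
    by (simp only: trisect_compose_mult trisect_add M zero_less_numeral)
  then show "trisect 0 (Z3 ^ 2) = 2 * \<tau> + 3 * \<tau> ^ 2"
    using Z1 by (simp add: \<tau>_def algebra_simps power2_eq_square)
  have "Z3 ^ (k + 3) = S3 (3 * \<tau>) * (Z3 ^ k + Z3 ^ (k + 1) + Z3 ^ (k + 2))"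
    unfolding power_add[of _ k] 3 by (simp add: hom algebra_simps power2_eq_square flip: numeral_fps_const)
  then show "trisect 0 (Z3 ^ (k + 3)) = 3 * \<tau> * (trisect 0 (Z3 ^ k) + trisect 0 (Z3 ^ (k + 1)) + trisect 0 (Z3 ^ (k + 2)))"
    by (simp only: trisect_compose_mult trisect_add zero_less_numeral)
qed

text \<open>Each use of the recurrence gains one \<tau> and lowers the index by at most 3. The bound
  is calibrated by the orders 0, 1, 1 at k = 0, 1, 2.\<close>

lemma trisect_Z3_divisible:
  "3 * j \<le> k + 2 \<Longrightarrow> \<exists>R\<in>int_polys \<tau>. trisect 0 (Z3 ^ k) = \<tau> ^ j * R"
proof (induction k arbitrary: j rule: less_induct)
  case (less k)
  note [intro] = int_polys_1 int_polys_times int_polys_add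
  have small: ?case if R: "R \<in> int_polys \<tau>" "trisect 0 (Z3 ^ k) = \<tau> * R" and j: "j \<le> 1" for R
  proof (cases "j = 0")
    case True
    then show ?thesis using R by auto
  next
    case False
    then have "j = 1" using j by simp
    then show ?thesis using R by auto
  qed
  have "k = 0 \<or> k = 1 \<or> k = 2 \<or> k = k - 3 + 3" by arith
  then consider "k = 0" | "k = 1" | "k = 2" | m where "k = m + 3" by blast
  then show ?case
  proof cases
    case 1
    then have "j = 0" using less.prems by simp
    with 1 trisect_Z3_recurrence(1) int_polys_1 show ?thesis by (intro bexI[of _ 1]) simp_all
  next
    case 2
    then show ?thesis using less.prems trisect_Z3_recurrence(2) by (intro small[of 1]) auto
  next
    case 3
    have "2 + 3 * \<tau> \<in> int_polys \<tau>"
      using int_polys_add[OF int_polys_of_int_mult[OF int_polys_times[OF int_polys_1], where m = 3 and t = \<tau>]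
          int_polys_of_int_mult[OF int_polys_1, where m = 2 and t = \<tau>]] by simp
    then show ?thesis
      using 3 less.prems trisect_Z3_recurrence(3)
      by (intro small[of "2 + 3 * \<tau>"]) (auto simp: algebra_simps power2_eq_square)
  next
    case 4
    \<comment> \<open>For j = 0 truncated subtraction gives i = 0; the surplus factor \<tau> is then
      absorbed into the polynomial.\<close>
    define i where "i = j - 1"
    have i: "3 * i \<le> m + 2" using less.prems 4 unfolding i_def by linarith
    obtain R0 R1 R2 where R: "R0 \<in> int_polys \<tau>" "R1 \<in> int_polys \<tau>" "R2 \<in> int_polys \<tau>"
      "trisect 0 (Z3 ^ m) = \<tau> ^ i * R0" "trisect 0 (Z3 ^ (m + 1)) = \<tau> ^ i * R1"
      "trisect 0 (Z3 ^ (m + 2)) = \<tau> ^ i * R2"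
      using less.IH[of m i] less.IH[of "m + 1" i] less.IH[of "m + 2" i] i 4 by auto
    define R where "R = of_int 3 * (R0 + R1 + R2)"
    have RP: "R \<in> int_polys \<tau>"
      unfolding R_def using R by (intro int_polys_of_int_mult) auto
    have eq: "trisect 0 (Z3 ^ k) = \<tau> ^ Suc i * R"
      unfolding 4 trisect_Z3_recurrence(4) R R_def by (simp add: algebra_simps)
    show ?thesis
    proof (cases "j = 0")
      case True
      then show ?thesis using eq RP by (auto simp: i_def)
    next
      case False
      then have "Suc i = j" by (simp add: i_def)
      with eq RP show ?thesis by auto
    qed
  qed
qed

text \<open>Here the factor 3 of the last recurrence step is kept outside the polynomial instead of
  being absorbed.\<close>

lemma trisect_Z3_divisible_3:
  assumes "3 \<le> k" "3 * j \<le> k + 2" "j > 0"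
  shows "\<exists>R\<in>int_polys \<tau>. trisect 0 (Z3 ^ k) = 3 * \<tau> ^ j * R"
proof -
  define m i where "m = k - 3" and "i = j - 1"
  have k: "k = m + 3" and j: "j = Suc i" using assms by (auto simp: m_def i_def)
  have i: "3 * i \<le> m + 2" using assms unfolding k j by simp
  obtain R0 R1 R2 where R: "R0 \<in> int_polys \<tau>" "R1 \<in> int_polys \<tau>" "R2 \<in> int_polys \<tau>"
    "trisect 0 (Z3 ^ m) = \<tau> ^ i * R0" "trisect 0 (Z3 ^ (m + 1)) = \<tau> ^ i * R1"
    "trisect 0 (Z3 ^ (m + 2)) = \<tau> ^ i * R2"
    using trisect_Z3_divisible[of i m] trisect_Z3_divisible[of i "m + 1"] trisect_Z3_divisible[of i "m + 2"] i by auto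
  have "trisect 0 (Z3 ^ k) = 3 * \<tau> ^ j * (R0 + R1 + R2)"
    unfolding k j trisect_Z3_recurrence(4) R by (simp add: algebra_simps)
  then show ?thesis using int_polys_add R by blast
qed

section \<open>Trisections of g and g^3 times polynomials in \<tau>\<close>

lemma Z3_power: "Z3 ^ k = S3 (cubic_gf ^ k) * (3 ^ k * fps_X ^ k * cubic_gf ^ k)"
  by (simp add: Z3_def power_mult_distrib fps_compose_power[symmetric] mult_ac)

lemma cubic_gf_nonzero: "cubic_gf \<noteq> 0"
  using cubic_gf_mult euler_nonzero[of 3] euler_nonzero[of 6] by auto

lemma fps_numeral_power_compose_X3: "(3 :: rat fps) ^ k oo fps_X ^ 3 = 3 ^ k"
  by (simp add: numeral_fps_const fps_const_power)

text \<open>Z^(4i+1) is a series in q^3 times q g \<tau>^i, up to a power of 3. Compute its residue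
  0 part through the recurrence and cancel the known factor C.\<close>

lemma trisect_2_term: "\<exists>R\<in>int_polys \<tau>. trisect 2 (cubic_gf * \<tau> ^ i) = 3 * cubic_gf ^ 3 * R"
proof -
  let ?g = cubic_gf
  obtain R where R: "R \<in> int_polys \<tau>" "trisect 0 (Z3 ^ (4 * i + 1)) = \<tau> ^ (i + 1) * R"
    using trisect_Z3_divisible[of "i + 1" "4 * i + 1"] by auto
  define C where "C = (3 ^ (4 * i + 1) * fps_X ^ (i + 1) * ?g ^ (4 * i + 1) :: rat fps)"
  have C0: "C \<noteq> 0" by (simp add: C_def cubic_gf_nonzero)
  \<comment> \<open>q^(3i) joins the series in q^3, q^i goes into \<tau>^i, and the remaining q
    moves residue 2 to residue 0.\<close>
  have X: "(fps_X :: rat fps) ^ (4 * i + 1) = fps_X ^ (3 * i) * fps_X ^ i * fps_X"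
    by (simp flip: power_add power_Suc2)
  have g: "?g ^ (4 * i + 1) = ?g ^ (4 * i) * ?g" by (simp add: power_add)
  have S: "S3 (3 ^ (4 * i + 1) * fps_X ^ i * ?g ^ (4 * i + 1)) = 3 ^ (4 * i + 1) * fps_X ^ (3 * i) * S3 (?g ^ (4 * i + 1))"
    by (simp add: C_def fps_compose_mult_distrib fps_numeral_power_compose_X3 X_power_compose_X3
        del: power_Suc)
  have eq: "9 ^ i * Z3 ^ (4 * i + 1) = S3 (3 ^ (4 * i + 1) * fps_X ^ i * ?g ^ (4 * i + 1)) * (fps_X * (?g * \<tau> ^ i))"
    unfolding Z3_power S X \<tau>_def power_mult_distrib power_mult[of ?g, symmetric]
    by (subst (2) g) (simp only: mult_ac)
  have nine: "(9 ^ i :: rat fps) = S3 (9 ^ i)" by (simp add: numeral_fps_const fps_const_power)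
  define D where "D = (3 ^ (4 * i + 1) * fps_X ^ i * ?g ^ (4 * i + 1) :: rat fps)"
  have "S3 (9 ^ i) * Z3 ^ (4 * i + 1) = S3 D * (fps_X * (?g * \<tau> ^ i))"
    by (simp only: eq D_def nine[symmetric])
  then have "trisect 0 (S3 (9 ^ i) * Z3 ^ (4 * i + 1)) = trisect 0 (S3 D * (fps_X * (?g * \<tau> ^ i)))"
    by (rule arg_cong)
  then have "9 ^ i * trisect 0 (Z3 ^ (4 * i + 1)) = D * (fps_X * trisect 2 (?g * \<tau> ^ i))"
    by (simp only: trisect_compose_mult zero_less_numeral trisect_X_power_mult)
  moreover have "D * (fps_X * trisect 2 (?g * \<tau> ^ i)) = C * trisect 2 (?g * \<tau> ^ i)"
    by (simp add: C_def D_def)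
  ultimately have "9 ^ i * trisect 0 (Z3 ^ (4 * i + 1)) = C * trisect 2 (?g * \<tau> ^ i)" by simp
  then have "C * trisect 2 (?g * \<tau> ^ i) = 9 ^ i * (\<tau> ^ (i + 1) * R)" unfolding R by simp
  also have "\<dots> = C * (3 * ?g ^ 3 * R)"
  proof -
    \<comment> \<open>The threes number 2i on the left and 2i + 2 in \<tau>^(i+1), one more than the
      4i + 1 in C: this is the factor gained.\<close>
    have "(9 ^ i * 9 ^ (i + 1) :: rat fps) = (3 ^ 2) ^ i * (3 ^ 2) ^ (i + 1)" by simp
    also have "\<dots> = 3 ^ ((4 * i + 1) + 1)"
      unfolding power_mult[symmetric] power_add[symmetric] by (rule arg_cong[of _ _ "power 3"]) simp
    finally have "(9 ^ i * 9 ^ (i + 1) :: rat fps) = 3 ^ (4 * i + 1) * 3"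
      unfolding power_add[of _ "4 * i + 1"] power_one_right .
    moreover have "?g ^ (4 * (i + 1)) = ?g ^ (4 * i + 1) * ?g ^ 3"
      unfolding power_add[symmetric] by (rule arg_cong[of _ _ "power ?g"]) simp
    moreover have "9 ^ i * (\<tau> ^ (i + 1) * R)
        = (9 ^ i * 9 ^ (i + 1)) * fps_X ^ (i + 1) * ?g ^ (4 * (i + 1)) * R"
      unfolding \<tau>_def power_mult_distrib power_mult[symmetric] by (simp only: mult_ac)
    ultimately show ?thesis unfolding C_def by (simp only: mult_ac)
  qed
  finally show ?thesis using C0 R(1) by auto
qed

text \<open>As for residue 2, but q^(4i+3) splits with no q left over, so residue 0 is met directly.
  The 4i + 2 threes and the additional one from \<open>trisect_Z3_divisible_3\<close> exactly match
  the 4i + 3 in C.\<close>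

lemma trisect_0_term: "\<exists>R\<in>int_polys \<tau>. trisect 0 (cubic_gf ^ 3 * \<tau> ^ i) = cubic_gf * R"
proof -
  let ?g = cubic_gf
  obtain R where R: "R \<in> int_polys \<tau>" "trisect 0 (Z3 ^ (4 * i + 3)) = 3 * \<tau> ^ (i + 1) * R"
    using trisect_Z3_divisible_3[of "4 * i + 3" "i + 1"] by auto
  define C where "C = (3 ^ (4 * i + 3) * fps_X ^ (i + 1) * ?g ^ (4 * i + 3) :: rat fps)"
  have C0: "C \<noteq> 0" by (simp add: C_def cubic_gf_nonzero)
  have X: "(fps_X :: rat fps) ^ (4 * i + 3) = fps_X ^ (3 * (i + 1)) * fps_X ^ i"
    by (simp flip: power_add power_Suc2)
  have g: "?g ^ (4 * i + 3) = ?g ^ (4 * i) * ?g ^ 3" by (simp add: power_add)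
  have S: "S3 C = 3 ^ (4 * i + 3) * fps_X ^ (3 * (i + 1)) * S3 (?g ^ (4 * i + 3))"
    by (simp add: C_def fps_compose_mult_distrib fps_numeral_power_compose_X3 X_power_compose_X3
        del: power_Suc)
  have eq: "9 ^ i * Z3 ^ (4 * i + 3) = S3 C * (?g ^ 3 * \<tau> ^ i)"
    unfolding Z3_power S X \<tau>_def power_mult_distrib power_mult[of ?g, symmetric]
    by (subst (2) g) (simp only: mult_ac)
  have nine: "(9 ^ i :: rat fps) = S3 (9 ^ i)" by (simp add: numeral_fps_const fps_const_power)
  have "9 ^ i * trisect 0 (Z3 ^ (4 * i + 3)) = C * trisect 0 (?g ^ 3 * \<tau> ^ i)"
    using arg_cong[OF eq, of "trisect 0"]
    by (subst (asm) nine) (simp only: trisect_compose_mult zero_less_numeral)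
  then have "C * trisect 0 (?g ^ 3 * \<tau> ^ i) = 9 ^ i * (3 * \<tau> ^ (i + 1) * R)" unfolding R by simp
  also have "\<dots> = C * (?g * R)"
  proof -
    have "(9 ^ i * 9 ^ (i + 1) * 3 :: rat fps) = (3 ^ 2) ^ i * (3 ^ 2) ^ (i + 1) * 3 ^ 1" by simp
    also have "\<dots> = 3 ^ (4 * i + 3)"
      unfolding power_mult[symmetric] power_add[symmetric] by (rule arg_cong[of _ _ "power 3"]) simp
    finally have "(9 ^ i * 9 ^ (i + 1) * 3 :: rat fps) = 3 ^ (4 * i + 3)" .
    moreover have "?g ^ (4 * (i + 1)) = ?g ^ (4 * i + 3) * ?g" by (simp flip: power_Suc2)
    moreover have "9 ^ i * (3 * \<tau> ^ (i + 1) * R)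
        = (9 ^ i * 9 ^ (i + 1) * 3) * fps_X ^ (i + 1) * ?g ^ (4 * (i + 1)) * R"
      unfolding \<tau>_def power_mult_distrib power_mult[symmetric] by (simp only: mult_ac)
    ultimately show ?thesis unfolding C_def by (simp only: mult_ac)
  qed
  finally show ?thesis using C0 R(1) by auto
qed

lemma trisect_2_int_polys:
  assumes "x \<in> int_polys \<tau>"
  shows "\<exists>R\<in>int_polys \<tau>. trisect 2 (cubic_gf * x) = 3 * cubic_gf ^ 3 * R"
  using assms
proof induction
  case zero
  then show ?case by (auto intro: int_polys.zero)
next
  case (add_term x c i)
  from add_term.IH obtain R where R: "R \<in> int_polys \<tau>" "trisect 2 (cubic_gf * x) = 3 * cubic_gf ^ 3 * R" by blast
  from trisect_2_term obtain R' where R': "R' \<in> int_polys \<tau>" "trisect 2 (cubic_gf * \<tau> ^ i) = 3 * cubic_gf ^ 3 * R'" by blast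
  have "cubic_gf * (x + of_int c * \<tau> ^ i) = cubic_gf * x + of_int c * (cubic_gf * \<tau> ^ i)"
    by (simp add: algebra_simps)
  then have "trisect 2 (cubic_gf * (x + of_int c * \<tau> ^ i)) = 3 * cubic_gf ^ 3 * (R + of_int c * R')"
    by (simp only: trisect_add trisect_of_int_mult R R') (simp add: algebra_simps)
  then show ?case using int_polys_add int_polys_of_int_mult R(1) R'(1) by blast
qed

lemma trisect_0_int_polys:
  assumes "x \<in> int_polys \<tau>"
  shows "\<exists>R\<in>int_polys \<tau>. trisect 0 (cubic_gf ^ 3 * x) = cubic_gf * R"
  using assms
proof induction
  case zero
  then show ?case by (auto intro: int_polys.zero)
next
  case (add_term x c i)
  from add_term.IH obtain R where R: "R \<in> int_polys \<tau>" "trisect 0 (cubic_gf ^ 3 * x) = cubic_gf * R" by blast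
  from trisect_0_term obtain R' where R': "R' \<in> int_polys \<tau>" "trisect 0 (cubic_gf ^ 3 * \<tau> ^ i) = cubic_gf * R'" by blast
  have "cubic_gf ^ 3 * (x + of_int c * \<tau> ^ i) = cubic_gf ^ 3 * x + of_int c * (cubic_gf ^ 3 * \<tau> ^ i)"
    by (simp add: algebra_simps)
  then have "trisect 0 (cubic_gf ^ 3 * (x + of_int c * \<tau> ^ i)) = cubic_gf * (R + of_int c * R')"
    by (simp only: trisect_add trisect_of_int_mult R R') (simp add: algebra_simps)
  then show ?case using int_polys_add int_polys_of_int_mult R(1) R'(1) by blast
qed

section \<open>Reduction modulo 3\<close>

lemma int_fps_tau: "int_fps \<tau>"
  unfolding \<tau>_def by (intro int_fps_mult int_fps_numeral int_fps_X int_fps_power int_fps_cubic_gf)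

lemma int_fps_int_polys: "x \<in> int_polys \<tau> \<Longrightarrow> int_fps x"
  by (induction rule: int_polys.induct) (intro int_fps_0 int_fps_add int_fps_mult int_fps_of_int int_fps_power int_fps_tau)+

text \<open>The cubic equation for Z divided by 27 q^3 g(q^3)^3; it shows g^3 congruent to g(q^3)
  modulo 3 with an explicit integral error.\<close>

lemma cubic_gf_cube: "cubic_gf ^ 3 = S3 cubic_gf + 3 * (S3 cubic_gf * (fps_X * (cubic_gf * S3 cubic_gf)
    + 3 * fps_X ^ 2 * (cubic_gf * S3 cubic_gf) ^ 2))"
proof -
  let ?G = "S3 cubic_gf"
  obtain p where "Z3 ^ 3 = 3 * S3 \<tau> * (1 + Z3 + Z3 ^ 2)" by (rule Z3_relations)
  then have "27 * fps_X ^ 3 * ?G ^ 3 * cubic_gf ^ 3 = 27 * fps_X ^ 3 * ?G ^ 3 *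
     (?G + 3 * (?G * (fps_X * (cubic_gf * ?G) + 3 * fps_X ^ 2 * (cubic_gf * ?G) ^ 2)))"
    unfolding S3_tau Z3_def by (simp add: algebra_simps power2_eq_square power3_eq_cube power4_eq_xxxx)
  moreover have "27 * fps_X ^ 3 * ?G ^ 3 \<noteq> 0"
    using cubic_gf_nonzero by (simp add: fps_compose_eq_0_iff)
  ultimately show ?thesis by (simp only: mult_cancel_left) blast
qed

text \<open>Since 9 divides \<tau>, only the constant terms of x survive modulo 3, and there
  \<open>cubic_gf_cube\<close> applies. At indices prime to 3 the coefficients come from 3 B
  alone.\<close>

lemma cubic_gf_cube_int_polys:
  assumes "x \<in> int_polys \<tau>"
  shows "\<exists>A B. int_fps B \<and> cubic_gf ^ 3 * x = S3 A + 3 * B"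
  using assms
proof induction
  case zero
  have "int_fps 0 \<and> cubic_gf ^ 3 * 0 = S3 0 + 3 * 0" by (simp add: int_fps_0)
  then show ?case by blast
next
  case (add_term x c i)
  note ints = int_fps_mult int_fps_add int_fps_numeral int_fps_X int_fps_power int_fps_cubic_gf
    int_fps_compose int_fps_of_int int_fps_tau
  from add_term.IH obtain A B where AB: "int_fps B" "cubic_gf ^ 3 * x = S3 A + 3 * B" by blast
  have "\<exists>A B. int_fps B \<and> cubic_gf ^ 3 * (of_int c * \<tau> ^ i) = S3 A + 3 * B"
  proof (cases i)
    case 0
    let ?B = "of_int c * (S3 cubic_gf * (fps_X * (cubic_gf * S3 cubic_gf)
      + 3 * fps_X ^ 2 * (cubic_gf * S3 cubic_gf) ^ 2))"
    have "int_fps ?B" by (intro ints)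
    moreover have "S3 (of_int c * cubic_gf) = of_int c * S3 cubic_gf"
      by (simp add: fps_compose_mult_distrib flip: fps_of_int)
    then have "cubic_gf ^ 3 * (of_int c * \<tau> ^ i) = S3 (of_int c * cubic_gf) + 3 * ?B"
      unfolding 0 cubic_gf_cube by (simp add: algebra_simps)
    ultimately show ?thesis by blast
  next
    case (Suc j)
    let ?B = "of_int c * (3 * fps_X * cubic_gf ^ 4 * \<tau> ^ j * cubic_gf ^ 3)"
    have "int_fps ?B" by (intro ints)
    moreover have "cubic_gf ^ 3 * (of_int c * \<tau> ^ i) = S3 0 + 3 * ?B"
      unfolding Suc power_Suc by (subst \<tau>_def) simp
    ultimately show ?thesis by blast
  qed
  then obtain A' B' where AB': "int_fps B'" "cubic_gf ^ 3 * (of_int c * \<tau> ^ i) = S3 A' + 3 * B'" by blast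
  have "cubic_gf ^ 3 * (x + of_int c * \<tau> ^ i) = S3 (A + A') + 3 * (B + B')"
    unfolding distrib_left AB AB' by (simp add: fps_compose_add_distrib)
  then show ?case using int_fps_add[OF AB(1) AB'(1)] by blast
qed

text \<open>The two claims alternate: residue 2 leads from the first at \<alpha> to the second at
  \<alpha>, and residue 0 leads on to the first at \<alpha> + 1. The start is R = 1.\<close>

lemma a3_dissection:
  fixes \<alpha> :: nat
  shows "\<exists>R\<in>int_polys \<tau>. \<forall>n. a3 (9 ^ \<alpha> * n + (9 ^ \<alpha> - 1) div 4) = 3 ^ \<alpha> * (cubic_gf * R) $ n"
    and "\<exists>R\<in>int_polys \<tau>. \<forall>n. a3 (3 * 9 ^ \<alpha> * n + (9 ^ (\<alpha> + 1) - 1) div 4) = 3 ^ (\<alpha> + 1) * (cubic_gf ^ 3 * R) $ n"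
proof -
  define P where "P = (\<lambda>\<alpha>. \<exists>R\<in>int_polys \<tau>. \<forall>n. a3 (9 ^ \<alpha> * n + (9 ^ \<alpha> - 1) div 4) = 3 ^ \<alpha> * (cubic_gf * R) $ n)"
  define Q where "Q = (\<lambda>\<alpha>. \<exists>R\<in>int_polys \<tau>. \<forall>n. a3 (3 * 9 ^ \<alpha> * n + (9 ^ (\<alpha> + 1) - 1) div 4) = 3 ^ (\<alpha> + 1) * (cubic_gf ^ 3 * R) $ n)"
  have PQ: "Q \<alpha>" if P: "P \<alpha>" for \<alpha>
  proof -
    from P obtain R where R: "R \<in> int_polys \<tau>"
      "\<And>n. a3 (9 ^ \<alpha> * n + (9 ^ \<alpha> - 1) div 4) = 3 ^ \<alpha> * (cubic_gf * R) $ n"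
      unfolding P_def by blast
    obtain R' where R': "R' \<in> int_polys \<tau>" "trisect 2 (cubic_gf * R) = 3 * cubic_gf ^ 3 * R'"
      using trisect_2_int_polys[OF R(1)] by blast
    \<comment> \<open>Needed because \<open>div\<close> on naturals must be exact in the index
      identities.\<close>
    have "(9::nat) ^ \<alpha> mod 4 = 1" using power_mod[of "9::nat" 4 \<alpha>] by simp
    then obtain k where k: "(9::nat) ^ \<alpha> = 4 * k + 1" by (metis mult_div_mod_eq)
    have "a3 (3 * 9 ^ \<alpha> * n + (9 ^ (\<alpha> + 1) - 1) div 4) = 3 ^ (\<alpha> + 1) * (cubic_gf ^ 3 * R') $ n" for n
    proof -
      \<comment> \<open>Uses 2 * 9^\<alpha> + (9^\<alpha> - 1)/4 = (9^(\<alpha>+1) - 1)/4.\<close>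
      have eq: "9 ^ \<alpha> * (3 * n + 2) + (9 ^ \<alpha> - 1) div 4 = 3 * 9 ^ \<alpha> * n + (9 ^ (\<alpha> + 1) - 1) div 4"
        unfolding power_add power_one_right k by (simp add: algebra_simps)
      have "a3 (3 * 9 ^ \<alpha> * n + (9 ^ (\<alpha> + 1) - 1) div 4) = 3 ^ \<alpha> * (trisect 2 (cubic_gf * R)) $ n"
        unfolding trisect_nth R(2)[symmetric] eq ..
      then show ?thesis unfolding R'(2) by (simp add: numeral_fps_const mult.assoc)
    qed
    then show ?thesis unfolding Q_def using R'(1) by blast
  qed
  have QP: "P (Suc \<alpha>)" if Q: "Q \<alpha>" for \<alpha>
  proof -
    from Q obtain R where R: "R \<in> int_polys \<tau>"
      "\<And>n. a3 (3 * 9 ^ \<alpha> * n + (9 ^ (\<alpha> + 1) - 1) div 4) = 3 ^ (\<alpha> + 1) * (cubic_gf ^ 3 * R) $ n"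
      unfolding Q_def by blast
    obtain R' where R': "R' \<in> int_polys \<tau>" "trisect 0 (cubic_gf ^ 3 * R) = cubic_gf * R'"
      using trisect_0_int_polys[OF R(1)] by blast
    have "a3 (9 ^ Suc \<alpha> * n + (9 ^ Suc \<alpha> - 1) div 4) = 3 ^ Suc \<alpha> * (cubic_gf * R') $ n" for n
      using R(2)[of "3 * n"] unfolding R'(2)[symmetric] by (simp add: mult_ac)
    then show ?thesis unfolding P_def using R'(1) by blast
  qed
  have "P 0" unfolding P_def using int_polys_1 by (auto simp: a3_eq intro!: bexI[of _ 1])
  then have P: "P \<alpha>" for \<alpha> by (induction \<alpha>) (auto intro: PQ QP)
  then show "\<exists>R\<in>int_polys \<tau>. \<forall>n. a3 (9 ^ \<alpha> * n + (9 ^ \<alpha> - 1) div 4) = 3 ^ \<alpha> * (cubic_gf * R) $ n"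
    unfolding P_def .
  from PQ[OF P] show "\<exists>R\<in>int_polys \<tau>. \<forall>n. a3 (3 * 9 ^ \<alpha> * n + (9 ^ (\<alpha> + 1) - 1) div 4) = 3 ^ (\<alpha> + 1) * (cubic_gf ^ 3 * R) $ n"
    unfolding Q_def .
qed

theorem theorem1p1:
  fixes \<alpha> n :: nat
  shows "(\<exists>c::int. a3 (3^(2*\<alpha>) * n + (3^(2*\<alpha>) - 1) div 4) = of_int (3^\<alpha> * c))
       \<and> (\<exists>c::int. a3 (3^(2*\<alpha>+1) * n + (3^(2*\<alpha>+2) - 1) div 4) = of_int (3^(\<alpha>+1) * c))
       \<and> (\<exists>c::int. a3 (3^(2*\<alpha>+2) * n + (7 * 3^(2*\<alpha>+1) - 1) div 4) = of_int (3^(\<alpha>+2) * c))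
       \<and> (\<exists>c::int. a3 (3^(2*\<alpha>+2) * n + (11 * 3^(2*\<alpha>+1) - 1) div 4) = of_int (3^(\<alpha>+2) * c))"
proof -
  have int_coeff: "\<exists>c. F $ m = of_int c" if "int_fps F" for F m
    using that by (auto simp: int_fps_def elim: Ints_cases)
  obtain R where R: "R \<in> int_polys \<tau>"
    "\<And>n. a3 (9 ^ \<alpha> * n + (9 ^ \<alpha> - 1) div 4) = 3 ^ \<alpha> * (cubic_gf * R) $ n"
    using a3_dissection(1) by blast
  obtain R' where R': "R' \<in> int_polys \<tau>"
    "\<And>n. a3 (3 * 9 ^ \<alpha> * n + (9 ^ (\<alpha> + 1) - 1) div 4) = 3 ^ (\<alpha> + 1) * (cubic_gf ^ 3 * R') $ n"
    using a3_dissection(2) by blast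
  obtain A B where AB: "int_fps B" "cubic_gf ^ 3 * R' = S3 A + 3 * B"
    using cubic_gf_cube_int_polys[OF R'(1)] by blast
  \<comment> \<open>At such m the series in q^3 contributes nothing, so the coefficient is 3 times
    one of the integral series B.\<close>
  have third: "\<exists>c. a3 (3 * 9 ^ \<alpha> * m + (9 ^ (\<alpha> + 1) - 1) div 4) = of_int (3 ^ (\<alpha> + 2) * c)"
    if "\<not> 3 dvd m" for m
  proof -
    obtain c where "B $ m = of_int c" using int_coeff[OF AB(1)] by blast
    then have "(cubic_gf ^ 3 * R') $ m = 3 * of_int c"
      using that unfolding AB(2) by (simp add: fps_nth_compose_X_power numeral_fps_const)
    then show ?thesis unfolding R'(2) by (intro exI[of _ c]) simp
  qed
  have p: "(3::nat) ^ (2 * \<alpha>) = 9 ^ \<alpha>" by (simp add: power_mult)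
  have "(9::nat) ^ \<alpha> mod 4 = 1" using power_mod[of "9::nat" 4 \<alpha>] by simp
  then obtain k where k: "(9::nat) ^ \<alpha> = 4 * k + 1" by (metis mult_div_mod_eq)
  have p1: "(3::nat) ^ (2 * \<alpha> + 1) = 3 * 9 ^ \<alpha>" and p2: "(3::nat) ^ (2 * \<alpha> + 2) = 9 ^ (\<alpha> + 1)"
    by (simp_all add: power_add p)
  have "\<exists>c. a3 (3^(2*\<alpha>) * n + (3^(2*\<alpha>) - 1) div 4) = of_int (3^\<alpha> * c)"
  proof -
    have "int_fps (cubic_gf * R)" using R(1) by (intro int_fps_mult int_fps_cubic_gf int_fps_int_polys)
    then obtain c where "(cubic_gf * R) $ n = of_int c" using int_coeff by blast
    then show ?thesis unfolding p R(2) by (intro exI[of _ c]) simp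
  qed
  moreover have "\<exists>c. a3 (3^(2*\<alpha>+1) * n + (3^(2*\<alpha>+2) - 1) div 4) = of_int (3^(\<alpha>+1) * c)"
  proof -
    have "int_fps (cubic_gf ^ 3 * R')"
      using R'(1) by (intro int_fps_mult int_fps_power int_fps_cubic_gf int_fps_int_polys)
    then obtain c where "(cubic_gf ^ 3 * R') $ n = of_int c" using int_coeff by blast
    then show ?thesis unfolding p1 p2 R'(2) by (intro exI[of _ c]) simp
  qed
  moreover have "\<exists>c. a3 (3^(2*\<alpha>+2) * n + (7 * 3^(2*\<alpha>+1) - 1) div 4) = of_int (3^(\<alpha>+2) * c)"
  proof -
    \<comment> \<open>Comparing multiples of 9^\<alpha>/4: 7 * 3 = 12 + 9 gives the index 3n + 1,
      and below 11 * 3 = 24 + 9 gives 3n + 2.\<close>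
    have "3^(2*\<alpha>+2) * n + (7 * 3^(2*\<alpha>+1) - 1) div 4 = 3 * 9 ^ \<alpha> * (3 * n + 1) + (9 ^ (\<alpha> + 1) - 1) div 4"
      unfolding p1 p2 by (simp add: k algebra_simps)
    moreover have "\<not> 3 dvd 3 * n + 1" by presburger
    ultimately show ?thesis using third by metis
  qed
  moreover have "\<exists>c. a3 (3^(2*\<alpha>+2) * n + (11 * 3^(2*\<alpha>+1) - 1) div 4) = of_int (3^(\<alpha>+2) * c)"
  proof -
    have "3^(2*\<alpha>+2) * n + (11 * 3^(2*\<alpha>+1) - 1) div 4 = 3 * 9 ^ \<alpha> * (3 * n + 2) + (9 ^ (\<alpha> + 1) - 1) div 4"
      unfolding p1 p2 by (simp add: k algebra_simps)
    moreover have "\<not> 3 dvd 3 * n + 2" by presburger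
    ultimately show ?thesis using third by metis
  qed
  ultimately show ?thesis by blast
qed

end
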